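(* Let $\pi=(G_0\xRightarrow{\rho_1}G_1\xRightarrow{\rho_2}\cdots\xRightarrow{\rho_n}G_n)$ be a finite path of linear DPO derivations in $\mathcal C$, and let $G_0\xleftarrow{u_\pi}D_\pi\xrightarrow{v_\pi}G_n$ be a representative (with both legs monic) of its track map $\operatorname{trk}(\pi)$. A subobject $A\le G_0$ transports intact through every step of $\pi$ if and only if $A\le u_\pi(D_\pi)$ in $\operatorname{Sub}(G_0)$. Thus $u_\pi(D_\pi)$ is the greatest pathwise transport domain.
   Context: Let $\mathcal H$ be the small category with a distinguished object $V$ and objects $E_{n,m}$ for $(n,m)\in\mathbb N^2$, freely generated by morphisms $s_i:E_{n,m}\to V$ ($1\le i\le n$) and $t_j:E_{n,m}\to V$ ($1\le j\le m$), with no equations beyond the category axioms. Let $\mathcal C=[\mathcal H,\mathbf{Set}]/\Sigma$ for a fixed $\Sigma\in[\mathcal H,\mathbf{Set}]$ (a Grothendieck topos). $\operatorname{Sub}(X)$ is the poset of subobjects of $X$. A linear DPO rule is a span of monomorphisms $L\xleftarrow{\ell}K\xrightarrow{r}R$. Given a monic match $m:L\hookrightarrow G$, a direct derivation $\rho:G\Rightarrow H$ consists of an object $D$ (the context) and morphisms $k:K\to D$, $d:D\to G$, $h:D\to H$, $n:R\to H$ such that the squares $m\ell=dk$ and $nr=hk$ are both pushouts; then $d,h$ are monic. Its track span is $\operatorname{trk}(\rho)=(G\xleftarrow{d}D\xrightarrow{h}H)$. A subobject $A\le G$ is $\rho$-stable if $A\wedge L\le K$ in $\operatorname{Sub}(G)$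 (with $L,K$ identified with their images in $G$); a $\rho$-stable $a:A\hookrightarrow G$ factors uniquely as $a=d\bar a$ and its transport is $\rho_{\#}(A)$, the subobject of $H$ represented by $h\bar a:A\hookrightarrow H$. $\mathbf{Par}(\mathcal C)$ is the category whose morphisms $X\rightharpoonup Y$ are isomorphism classes of spans $X\xleftarrow{u}M\xrightarrow{v}Y$ with $u$ monic, composed by pullback. The track map of the path is $\operatorname{trk}(\pi)=\operatorname{trk}(\rho_n)\circ\cdots\circ\operatorname{trk}(\rho_1)$ in $\mathbf{Par}(\mathcal C)$. $A\le G_0$ transports intact through every step of $\pi$ when, setting $A_0=A$, each $A_{i-1}\le G_{i-1}$ is $\rho_i$-stable and $A_i:=(\rho_i)_{\#}(A_{i-1})\le G_i$, for $i=1,\dots,n$. *)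

theory Defs
  imports "HOL-Algebra.Lattice"
begin

section \<open>Categories\<close>

record ('o, 'm) cat =
  Obj :: "'o set"
  Arr :: "'m set"
  Dom :: "'m \<Rightarrow> 'o"
  Cod :: "'m \<Rightarrow> 'o"
  Ident :: "'o \<Rightarrow> 'm"
  Comp :: "'m \<Rightarrow> 'm \<Rightarrow> 'm" (infixl \<open>\<cdot>\<index>\<close> 70)

text \<open>Composition is in applicative order: \<open>g \<cdot> f\<close> is meaningful if \<open>Cod f = Dom g\<close>;
  its value on other pairs is junk, so every statement below carries the typing explicitly.\<close>

definition arrow :: "('o, 'm) cat \<Rightarrow> 'o \<Rightarrow> 'o \<Rightarrow> 'm set" where
  "arrow C X Y = {f \<in> Arr C. Dom C f = X \<and> Cod C f = Y}"

definition monic :: "('o, 'm) cat \<Rightarrow> 'm \<Rightarrow> bool" where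
  "monic C f \<longleftrightarrow> f \<in> Arr C \<and>
     (\<forall>X \<in> Obj C. \<forall>g \<in> arrow C X (Dom C f). \<forall>h \<in> arrow C X (Dom C f).
        f \<cdot>\<^bsub>C\<^esub> g = f \<cdot>\<^bsub>C\<^esub> h \<longrightarrow> g = h)"

definition iso :: "('o, 'm) cat \<Rightarrow> 'm \<Rightarrow> bool" where
  "iso C f \<longleftrightarrow> f \<in> Arr C \<and>
     (\<exists>g \<in> arrow C (Cod C f) (Dom C f).
        g \<cdot>\<^bsub>C\<^esub> f = Ident C (Dom C f) \<and> f \<cdot>\<^bsub>C\<^esub> g = Ident C (Cod C f))"

text \<open>\<open>pushout C f g p q\<close>: the square \<open>p \<cdot> f = q \<cdot> g\<close> is a pushout of the span
  \<open>\<bullet> \<leftarrow>f\<midarrow> \<bullet> \<midarrow>g\<rightarrow> \<bullet>\<close>.\<close>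

definition pushout :: "('o, 'm) cat \<Rightarrow> 'm \<Rightarrow> 'm \<Rightarrow> 'm \<Rightarrow> 'm \<Rightarrow> bool" where
  "pushout C f g p q \<longleftrightarrow>
     {f, g, p, q} \<subseteq> Arr C \<and>
     Dom C f = Dom C g \<and> Dom C p = Cod C f \<and> Dom C q = Cod C g \<and> Cod C p = Cod C q \<and>
     p \<cdot>\<^bsub>C\<^esub> f = q \<cdot>\<^bsub>C\<^esub> g \<and>
     (\<forall>X \<in> Obj C. \<forall>p' \<in> arrow C (Cod C f) X. \<forall>q' \<in> arrow C (Cod C g) X.
        p' \<cdot>\<^bsub>C\<^esub> f = q' \<cdot>\<^bsub>C\<^esub> g \<longrightarrow>
        (\<exists>!t. t \<in> arrow C (Cod C p) X \<and> t \<cdot>\<^bsub>C\<^esub> p = p' \<and> t \<cdot>\<^bsub>C\<^esub> q = q'))"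

text \<open>\<open>pullback C f g p q\<close>: the square \<open>f \<cdot> p = g \<cdot> q\<close> is a pullback of the cospan
  \<open>\<bullet> \<midarrow>f\<rightarrow> \<bullet> \<leftarrow>g\<midarrow> \<bullet>\<close>.\<close>

definition pullback :: "('o, 'm) cat \<Rightarrow> 'm \<Rightarrow> 'm \<Rightarrow> 'm \<Rightarrow> 'm \<Rightarrow> bool" where
  "pullback C f g p q \<longleftrightarrow>
     {f, g, p, q} \<subseteq> Arr C \<and>
     Cod C f = Cod C g \<and> Cod C p = Dom C f \<and> Cod C q = Dom C g \<and> Dom C p = Dom C q \<and>
     f \<cdot>\<^bsub>C\<^esub> p = g \<cdot>\<^bsub>C\<^esub> q \<and>
     (\<forall>X \<in> Obj C. \<forall>p' \<in> arrow C X (Dom C f). \<forall>q' \<in> arrow C X (Dom C g).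
        f \<cdot>\<^bsub>C\<^esub> p' = g \<cdot>\<^bsub>C\<^esub> q' \<longrightarrow>
        (\<exists>!t. t \<in> arrow C X (Dom C p) \<and> p \<cdot>\<^bsub>C\<^esub> t = p' \<and> q \<cdot>\<^bsub>C\<^esub> t = q'))"


section \<open>The poset of subobjects\<close>

definition sub_class :: "('o, 'm) cat \<Rightarrow> 'm \<Rightarrow> 'm set" where
  "sub_class C a =
     {a \<cdot>\<^bsub>C\<^esub> i | i. iso C i \<and> Cod C i = Dom C a}"

definition Sub :: "('o, 'm) cat \<Rightarrow> 'o \<Rightarrow> 'm set gorder" where
  "Sub C X =
     \<lparr> carrier = {sub_class C a | a. monic C a \<and> Cod C a = X},
       eq = (=),
       le = (\<lambda>A B. \<exists>a \<in> A. \<exists>b \<in> B. \<exists>f \<in> arrow C (Dom C a) (Dom C b). a = b \<cdot>\<^bsub>C\<^esub> f) \<rparr>"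


section \<open>The category of partial maps\<close>

text \<open>A span \<open>X \<leftarrow>u\<midarrow> M \<midarrow>v\<rightarrow> Y\<close> is the pair \<open>(u, v)\<close> of its legs.\<close>

definition is_span :: "('o, 'm) cat \<Rightarrow> 'o \<Rightarrow> 'o \<Rightarrow> 'm \<times> 'm \<Rightarrow> bool" where
  "is_span C X Y s \<longleftrightarrow> (case s of (u, v) \<Rightarrow>
     u \<in> Arr C \<and> v \<in> Arr C \<and> Dom C u = Dom C v \<and> Cod C u = X \<and> Cod C v = Y)"

definition span_class :: "('o, 'm) cat \<Rightarrow> 'm \<times> 'm \<Rightarrow> ('m \<times> 'm) set" where
  "span_class C s = (case s of (u, v) \<Rightarrow>
     {(u \<cdot>\<^bsub>C\<^esub> i, v \<cdot>\<^bsub>C\<^esub> i) | i. iso C i \<and> Cod C i = Dom C u})"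

text \<open>A partial map is a triple consisting of its source, an isomorphism class of spans, and its
  target. In the composite the unions range over all representatives and all choices of
  pullback; all of these contribute the same isomorphism class.\<close>

type_synonym ('o, 'm) partial_map = "'o \<times> ('m \<times> 'm) set \<times> 'o"

definition reps :: "('o, 'm) partial_map \<Rightarrow> ('m \<times> 'm) set" where
  "reps t = fst (snd t)"

definition Par :: "('o, 'm) cat \<Rightarrow> ('o, ('o, 'm) partial_map) cat" where
  "Par C =
     \<lparr> Obj = Obj C,
       Arr = {(X, span_class C (u, v), Y) | X u v Y.
                X \<in> Obj C \<and> Y \<in> Obj C \<and> is_span C X Y (u, v) \<and> monic C u},
       Dom = fst,
       Cod = (\<lambda>t. snd (snd t)),
       Ident = (\<lambda>X. (X, span_class C (Ident C X, Ident C X), X)),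
       Comp = (\<lambda>t s. (fst s,
                \<Union> {span_class C (u \<cdot>\<^bsub>C\<^esub> p, z \<cdot>\<^bsub>C\<^esub> q) | u v w z p q.
                      (u, v) \<in> reps s \<and> (w, z) \<in> reps t \<and> pullback C v w p q},
                snd (snd t))) \<rparr>"


section \<open>Double-pushout rewriting\<close>

text \<open>The arrows of a derivation are named as in the double-pushout diagram

    \<^verbatim>\<open>      L <--lft-- K --rgt--> R      \<close>
    \<^verbatim>\<open>      |         |          |      \<close>
    \<^verbatim>\<open>    mtch      kctx       comatch  \<close>
    \<^verbatim>\<open>      v         v          v      \<close>
    \<^verbatim>\<open>      G <--dleg-- D --hleg--> H    \<close>

  All objects are recovered as domains and codomains.\<close>

record 'm derivation =
  lft :: 'm
  rgt :: 'm
  mtch :: 'm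
  kctx :: 'm
  dleg :: 'm
  hleg :: 'm
  comatch :: 'm

definition linear_rule :: "('o, 'm) cat \<Rightarrow> 'm \<Rightarrow> 'm \<Rightarrow> bool" where
  "linear_rule C l r \<longleftrightarrow> monic C l \<and> monic C r \<and> Dom C l = Dom C r"

definition direct_derivation :: "('o, 'm) cat \<Rightarrow> 'o \<Rightarrow> 'm derivation \<Rightarrow> 'o \<Rightarrow> bool" where
  "direct_derivation C G \<rho> H \<longleftrightarrow>
     linear_rule C (lft \<rho>) (rgt \<rho>) \<and>
     monic C (mtch \<rho>) \<and> Dom C (mtch \<rho>) = Cod C (lft \<rho>) \<and>
     Cod C (mtch \<rho>) = G \<and> Cod C (comatch \<rho>) = H \<and>
     pushout C (lft \<rho>) (kctx \<rho>) (mtch \<rho>) (dleg \<rho>) \<and>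
     pushout C (rgt \<rho>) (kctx \<rho>) (comatch \<rho>) (hleg \<rho>)"

fun derivation_path :: "('o, 'm) cat \<Rightarrow> 'o \<Rightarrow> 'm derivation list \<Rightarrow> 'o \<Rightarrow> bool" where
  "derivation_path C G [] G' \<longleftrightarrow> G \<in> Obj C \<and> G' = G"
| "derivation_path C G (\<rho> # \<pi>) G' \<longleftrightarrow>
     (\<exists>H. direct_derivation C G \<rho> H \<and> derivation_path C H \<pi> G')"

definition trk :: "('o, 'm) cat \<Rightarrow> 'm derivation \<Rightarrow> ('o, 'm) partial_map" where
  "trk C \<rho> = (Cod C (dleg \<rho>), span_class C (dleg \<rho>, hleg \<rho>), Cod C (hleg \<rho>))"

text \<open>The track map of a path starting at \<open>G\<close>; for the empty path it is the identity.\<close>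

definition trk_path :: "('o, 'm) cat \<Rightarrow> 'o \<Rightarrow> 'm derivation list \<Rightarrow> ('o, 'm) partial_map" where
  "trk_path C G \<pi> = fold (\<lambda>\<rho> t. trk C \<rho> \<cdot>\<^bsub>Par C\<^esub> t) \<pi> (Ident (Par C) G)"

definition stable :: "('o, 'm) cat \<Rightarrow> 'm derivation \<Rightarrow> 'm set \<Rightarrow> bool" where
  "stable C \<rho> A \<longleftrightarrow>
     (let S = Sub C (Cod C (mtch \<rho>)) in
        A \<in> carrier S \<and>
        A \<sqinter>\<^bsub>S\<^esub> sub_class C (mtch \<rho>) \<sqsubseteq>\<^bsub>S\<^esub> sub_class C (mtch \<rho> \<cdot>\<^bsub>C\<^esub> lft \<rho>))"

text \<open>For a stable \<open>A\<close>, represented by \<open>a = d \<cdot> a'\<close>, this is the class of \<open>h \<cdot> a'\<close>.\<close>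

definition transport :: "('o, 'm) cat \<Rightarrow> 'm derivation \<Rightarrow> 'm set \<Rightarrow> 'm set" where
  "transport C \<rho> A =
     (THE B. \<exists>a' \<in> Arr C. Cod C a' = Dom C (dleg \<rho>) \<and>
        dleg \<rho> \<cdot>\<^bsub>C\<^esub> a' \<in> A \<and> B = sub_class C (hleg \<rho> \<cdot>\<^bsub>C\<^esub> a'))"

fun transports_intact :: "('o, 'm) cat \<Rightarrow> 'm derivation list \<Rightarrow> 'm set \<Rightarrow> bool" where
  "transports_intact C [] A \<longleftrightarrow> True"
| "transports_intact C (\<rho> # \<pi>) A \<longleftrightarrow>
     stable C \<rho> A \<and> transports_intact C \<pi> (transport C \<rho> A)"


section \<open>Functor categories and slices\<close>

text \<open>Functors, natural transformations and functions are made extensional (equal to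
  \<^const>\<open>undefined\<close> outside their carriers) so that equality of arrows is the intended one.\<close>

definition set_cat :: "('a set, 'a set \<times> ('a \<Rightarrow> 'a) \<times> 'a set) cat" where
  "set_cat =
     \<lparr> Obj = UNIV,
       Arr = {(A, f, B). f \<in> A \<rightarrow>\<^sub>E B},
       Dom = fst,
       Cod = (\<lambda>f. snd (snd f)),
       Ident = (\<lambda>A. (A, \<lambda>x\<in>A. x, A)),
       Comp = (\<lambda>(_, g, C) (A, f, _). (A, compose A g f, C)) \<rparr>"

record ('o, 'm, 'p, 'n) functor_data =
  FObj :: "'o \<Rightarrow> 'p"
  FArr :: "'m \<Rightarrow> 'n"

definition is_functor :: "('o, 'm) cat \<Rightarrow> ('p, 'n) cat \<Rightarrow> ('o, 'm, 'p, 'n) functor_data \<Rightarrow> bool" where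
  "is_functor A B F \<longleftrightarrow>
     FObj F \<in> Obj A \<rightarrow>\<^sub>E Obj B \<and>
     FArr F \<in> Arr A \<rightarrow>\<^sub>E Arr B \<and>
     (\<forall>f \<in> Arr A. FArr F f \<in> arrow B (FObj F (Dom A f)) (FObj F (Cod A f))) \<and>
     (\<forall>X \<in> Obj A. FArr F (Ident A X) = Ident B (FObj F X)) \<and>
     (\<forall>f \<in> Arr A. \<forall>g \<in> Arr A. Cod A f = Dom A g \<longrightarrow>
        FArr F (g \<cdot>\<^bsub>A\<^esub> f) = FArr F g \<cdot>\<^bsub>B\<^esub> FArr F f)"

type_synonym ('o, 'm, 'p, 'n) nat_trans =
  "('o, 'm, 'p, 'n) functor_data \<times> ('o \<Rightarrow> 'n) \<times> ('o, 'm, 'p, 'n) functor_data"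

definition is_nat_trans :: "('o, 'm) cat \<Rightarrow> ('p, 'n) cat \<Rightarrow> ('o, 'm, 'p, 'n) nat_trans \<Rightarrow> bool" where
  "is_nat_trans A B t \<longleftrightarrow> (case t of (F, \<eta>, G) \<Rightarrow>
     is_functor A B F \<and> is_functor A B G \<and> \<eta> \<in> extensional (Obj A) \<and>
     (\<forall>X \<in> Obj A. \<eta> X \<in> arrow B (FObj F X) (FObj G X)) \<and>
     (\<forall>f \<in> Arr A. \<eta> (Cod A f) \<cdot>\<^bsub>B\<^esub> FArr F f = FArr G f \<cdot>\<^bsub>B\<^esub> \<eta> (Dom A f)))"

definition functor_cat :: "('o, 'm) cat \<Rightarrow> ('p, 'n) cat \<Rightarrow>
    (('o, 'm, 'p, 'n) functor_data, ('o, 'm, 'p, 'n) nat_trans) cat" where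
  "functor_cat A B =
     \<lparr> Obj = {F. is_functor A B F},
       Arr = {t. is_nat_trans A B t},
       Dom = fst,
       Cod = (\<lambda>t. snd (snd t)),
       Ident = (\<lambda>F. (F, \<lambda>X\<in>Obj A. Ident B (FObj F X), F)),
       Comp = (\<lambda>(_, \<theta>, H) (F, \<eta>, _). (F, \<lambda>X\<in>Obj A. \<theta> X \<cdot>\<^bsub>B\<^esub> \<eta> X, H)) \<rparr>"

definition slice_cat :: "('o, 'm) cat \<Rightarrow> 'o \<Rightarrow> ('m, 'm \<times> 'm \<times> 'm) cat" where
  "slice_cat C S =
     \<lparr> Obj = {p \<in> Arr C. Cod C p = S},
       Arr = {(p, f, q). p \<in> Arr C \<and> q \<in> Arr C \<and> Cod C p = S \<and> Cod C q = S \<and>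
                f \<in> arrow C (Dom C p) (Dom C q) \<and> q \<cdot>\<^bsub>C\<^esub> f = p},
       Dom = fst,
       Cod = (\<lambda>t. snd (snd t)),
       Ident = (\<lambda>p. (p, Ident C (Dom C p), p)),
       Comp = (\<lambda>(_, g, r) (p, f, _). (p, g \<cdot>\<^bsub>C\<^esub> f, r)) \<rparr>"


section \<open>Typed hypergraphs\<close>

text \<open>The free category on a quiver with vertices \<open>W\<close>, edges \<open>Q\<close>, source \<open>s\<close> and target \<open>t\<close>:
  an arrow is a path together with its endpoints, edges being listed in the order in which they
  are traversed.\<close>

fun is_path :: "'v set \<Rightarrow> 'e set \<Rightarrow> ('e \<Rightarrow> 'v) \<Rightarrow> ('e \<Rightarrow> 'v) \<Rightarrow> 'v \<Rightarrow> 'e list \<Rightarrow> 'v \<Rightarrow> bool" where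
  "is_path W Q s t x [] y \<longleftrightarrow> x \<in> W \<and> y = x"
| "is_path W Q s t x (e # es) y \<longleftrightarrow>
     x \<in> W \<and> e \<in> Q \<and> s e = x \<and> is_path W Q s t (t e) es y"

definition free_cat :: "'v set \<Rightarrow> 'e set \<Rightarrow> ('e \<Rightarrow> 'v) \<Rightarrow> ('e \<Rightarrow> 'v) \<Rightarrow>
    ('v, 'v \<times> 'e list \<times> 'v) cat" where
  "free_cat W Q s t =
     \<lparr> Obj = W,
       Arr = {(x, es, y). is_path W Q s t x es y},
       Dom = fst,
       Cod = (\<lambda>f. snd (snd f)),
       Ident = (\<lambda>x. (x, [], x)),
       Comp = (\<lambda>(_, es', z) (x, es, _). (x, es @ es', z)) \<rparr>"

datatype hobj = HV | HE nat nat

text \<open>\<open>HS n m i\<close> and \<open>HT n m j\<close> are the generators \<open>s\<^sub>i, t\<^sub>j : E\<^sub>n\<^sub>,\<^sub>m \<rightarrow> V\<close>.\<close>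

datatype hgen = HS nat nat nat | HT nat nat nat

definition hgens :: "hgen set" where
  "hgens = {HS n m i | n m i. 1 \<le> i \<and> i \<le> n} \<union> {HT n m j | n m j. 1 \<le> j \<and> j \<le> m}"

fun hsrc :: "hgen \<Rightarrow> hobj" where
  "hsrc (HS n m i) = HE n m"
| "hsrc (HT n m j) = HE n m"

fun htgt :: "hgen \<Rightarrow> hobj" where
  "htgt (HS n m i) = HV"
| "htgt (HT n m j) = HV"

type_synonym harr = "hobj \<times> hgen list \<times> hobj"

definition H_cat :: "(hobj, harr) cat" where
  "H_cat = free_cat UNIV hgens hsrc htgt"

text \<open>\<open>[\<H>, Set]\<close>, where the sets are the subsets of a type \<open>'a\<close>. For infinite \<open>'a\<close> these are
  up to isomorphism the functors all of whose values have cardinality at most that of \<open>'a\<close>.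
  This full subcategory is closed under subobjects, finite limits and finite colimits of all
  functors, so monomorphisms, pullbacks and pushouts in it have their usual meaning. (For
  finite \<open>'a\<close> it is not closed under pushouts.)\<close>

type_synonym 'a set_arr = "'a set \<times> ('a \<Rightarrow> 'a) \<times> 'a set"
type_synonym 'a hgraph = "(hobj, harr, 'a set, 'a set_arr) functor_data"
type_synonym 'a hgraph_hom = "(hobj, harr, 'a set, 'a set_arr) nat_trans"
type_synonym 'a typed_hgraph = "'a hgraph_hom"
type_synonym 'a typed_hgraph_hom = "'a hgraph_hom \<times> 'a hgraph_hom \<times> 'a hgraph_hom"

definition hgraph_cat :: "('a hgraph, 'a hgraph_hom) cat" where
  "hgraph_cat = functor_cat H_cat set_cat"

definition typed_hgraph_cat :: "'a hgraph \<Rightarrow> ('a typed_hgraph, 'a typed_hgraph_hom) cat" where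
  "typed_hgraph_cat S = slice_cat hgraph_cat S"

end

theory Submission
  imports Defs
begin

text \<open>Typed hypergraphs have elements, namely their vertices and edges, and almost everything in the
  statement can be read off from sets of elements. A homomorphism is monic iff it is injective on
  elements, \<open>A \<le> B\<close> holds among subobjects iff the image of \<open>A\<close> is contained in the image of \<open>B\<close>,
  and the meet of two subobjects has as its image the intersection of their images. A pushout
  square along a monomorphism behaves as for sets: in a derivation with left square
  \<open>L \<leftarrow> K \<rightarrow> D\<close> over \<open>G\<close>, every element of \<open>G\<close> lies in \<open>L\<close> or in \<open>D\<close>, and it lies in both only if
  it lies in \<open>K\<close>. So if \<open>A \<inter> L \<subseteq> K\<close>, an element of \<open>A\<close> that is not already in \<open>D\<close> lies in
  \<open>L\<close>, hence in \<open>K\<close>, hence in \<open>D\<close>; conversely \<open>D \<inter> L = K\<close>. This proves \<open>stable_iff\<close>: a subobject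
  is stable iff it is contained in the context \<open>D\<close>, that is, in the domain of the track map.

  A path is handled by adding one derivation at the end. If \<open>(u, v)\<close> represents the track
  map so far, then a subobject \<open>u b\<close> of the domain \<open>u\<close> has been moved to \<open>v b\<close>. The next
  derivation, with track \<open>(w, z)\<close>, accepts \<open>v b\<close> iff \<open>v b\<close> factors through \<open>w\<close>, which by the
  universal property of the pullback \<open>(p, q)\<close> of \<open>v\<close> and \<open>w\<close> means that \<open>b\<close> factors through \<open>p\<close>,
  that is, that \<open>u b\<close> factors through \<open>u p\<close>; and \<open>u p\<close> is the left leg of the composite partial map.
  The lemma \<open>trk_path_tracks\<close> carries out this induction.

  The facts about elements are collected in the locale \<open>concrete_adhesive\<close>. They are verified for all
  categories of functors from a small category into the subsets of an infinite type
  (\<open>presheaf_cat_concrete_adhesive\<close>) and shown to be inherited by slices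
  (\<open>slice_concrete_adhesive\<close>). Infinity of the type lets kernel pairs, which consist of pairs of
  elements, and glued objects, which are disjoint sums, be coded in the type again.\<close>

section \<open>Categories with a well-behaved action on elements\<close>

text \<open>The typing part of a category. The equations are derived where the arrows act faithfully on
  sets, because composition of functions satisfies them.\<close>
locale precategory =
  fixes C :: "('o, 'm) cat" (structure)
  assumes Dom_Obj: "f \<in> Arr C \<Longrightarrow> Dom C f \<in> Obj C"
    and Cod_Obj: "f \<in> Arr C \<Longrightarrow> Cod C f \<in> Obj C"
    and Ident_arrow: "X \<in> Obj C \<Longrightarrow> Ident C X \<in> arrow C X X"
    and Comp_arrow: "\<lbrakk>f \<in> Arr C; g \<in> Arr C; Cod C f = Dom C g\<rbrakk>
      \<Longrightarrow> g \<cdot> f \<in> arrow C (Dom C f) (Cod C g)"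
begin

lemma Ident_simps [simp]:
  assumes "X \<in> Obj C"
  shows "Ident C X \<in> Arr C" "Dom C (Ident C X) = X" "Cod C (Ident C X) = X"
  using Ident_arrow[OF assms] by (auto simp: arrow_def)

lemma Comp_simps [simp]:
  assumes "f \<in> Arr C" "g \<in> Arr C" "Cod C f = Dom C g"
  shows "g \<cdot> f \<in> Arr C" "Dom C (g \<cdot> f) = Dom C f" "Cod C (g \<cdot> f) = Cod C g"
  using Comp_arrow[OF assms] by (auto simp: arrow_def)

end

text \<open>Every arrow acts on elements. The assumptions say that arrows are determined by their action,
  that monomorphisms embed elements and are determined up to factorization by their images, that
  subobjects are closed under binary intersections and unions, and (in \<open>glue\<close>) that a commuting square
  \<open>m l = d k\<close> with \<open>l\<close> injective factors through one that is cartesian on elements and has \<open>q\<close>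
  injective. In a presheaf category the latter is the pushout of \<open>l\<close> and \<open>k\<close>; stating it relative to a
  given square, without the universal property, makes it pass to slices, where the glued object is
  typed through \<open>t\<close>.\<close>
locale concrete_adhesive = precategory C
  for C :: "('o, 'm) cat" (structure) +
  fixes el :: "'o \<Rightarrow> 'e set" and act :: "'m \<Rightarrow> 'e \<Rightarrow> 'e" and im :: "'m \<Rightarrow> 'e set"
  defines "im f \<equiv> act f ` el (Dom C f)"
  assumes act_el: "\<lbrakk>f \<in> Arr C; x \<in> el (Dom C f)\<rbrakk> \<Longrightarrow> act f x \<in> el (Cod C f)"
    and act_Ident: "\<lbrakk>X \<in> Obj C; x \<in> el X\<rbrakk> \<Longrightarrow> act (Ident C X) x = x"
    and act_Comp: "\<lbrakk>f \<in> Arr C; g \<in> Arr C; Cod C f = Dom C g; x \<in> el (Dom C f)\<rbrakk>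
      \<Longrightarrow> act (g \<cdot> f) x = act g (act f x)"
    and faithful: "\<lbrakk>f \<in> Arr C; g \<in> Arr C; Dom C f = Dom C g; Cod C f = Cod C g;
      \<And>x. x \<in> el (Dom C f) \<Longrightarrow> act f x = act g x\<rbrakk> \<Longrightarrow> f = g"
    and monic_imp_inj: "monic C f \<Longrightarrow> inj_on (act f) (el (Dom C f))"
    and factor: "\<lbrakk>f \<in> Arr C; m \<in> Arr C; Cod C f = Cod C m; inj_on (act m) (el (Dom C m));
      im f \<subseteq> im m\<rbrakk> \<Longrightarrow> \<exists>t \<in> arrow C (Dom C f) (Dom C m). f = m \<cdot> t"
    and Int_image: "\<lbrakk>f \<in> Arr C; g \<in> Arr C; Cod C f = Cod C g\<rbrakk>
      \<Longrightarrow> \<exists>i \<in> Arr C. Cod C i = Cod C f \<and> inj_on (act i) (el (Dom C i)) \<and> im i = im f \<inter> im g"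
    and Un_image: "\<lbrakk>f \<in> Arr C; g \<in> Arr C; Cod C f = Cod C g\<rbrakk>
      \<Longrightarrow> \<exists>i \<in> Arr C. Cod C i = Cod C f \<and> inj_on (act i) (el (Dom C i)) \<and> im i = im f \<union> im g"
    and glue: "\<lbrakk>{l, k, m, d} \<subseteq> Arr C; Dom C l = Dom C k; Dom C m = Cod C l; Dom C d = Cod C k;
      Cod C m = Cod C d; m \<cdot> l = d \<cdot> k;
      inj_on (act l) (el (Dom C l))\<rbrakk>
      \<Longrightarrow> \<exists>P p q t. p \<in> arrow C (Cod C l) P \<and> q \<in> arrow C (Cod C k) P \<and> t \<in> arrow C P (Cod C m) \<and>
        p \<cdot> l = q \<cdot> k \<and> t \<cdot> p = m \<and> t \<cdot> q = d \<and>
        inj_on (act q) (el (Dom C q)) \<and> im p \<inter> im q \<subseteq> im (p \<cdot> l)"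
begin

lemma act_in_el: "\<lbrakk>f \<in> Arr C; Cod C f = Y; x \<in> el (Dom C f)\<rbrakk> \<Longrightarrow> act f x \<in> el Y"
  using act_el by blast

lemma assoc:
  assumes "f \<in> Arr C" "g \<in> Arr C" "h \<in> Arr C" "Cod C f = Dom C g" "Cod C g = Dom C h"
  shows "h \<cdot> (g \<cdot> f) = (h \<cdot> g) \<cdot> f"
  by (rule faithful) (use assms in \<open>simp_all add: act_Comp act_in_el\<close>)

lemma Comp_Ident [simp]:
  assumes "f \<in> Arr C" "Dom C f = X"
  shows "f \<cdot> Ident C X = f"
  by (rule faithful) (use assms Dom_Obj[of f] in \<open>auto simp: act_Comp act_Ident\<close>)

lemma Ident_Comp [simp]:
  assumes "f \<in> Arr C" "Cod C f = X"
  shows "Ident C X \<cdot> f = f"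
  by (rule faithful) (use assms Cod_Obj[of f] in \<open>auto simp: act_Comp act_Ident act_el\<close>)

lemma im_subset: "f \<in> Arr C \<Longrightarrow> im f \<subseteq> el (Cod C f)"
  by (auto simp: im_def act_el)

lemma im_Comp:
  assumes "f \<in> Arr C" "g \<in> Arr C" "Cod C f = Dom C g"
  shows "im (g \<cdot> f) = act g ` im f"
  using assms by (force simp: im_def act_Comp)

lemma im_Comp_subset:
  assumes "f \<in> Arr C" "g \<in> Arr C" "Cod C f = Dom C g"
  shows "im (g \<cdot> f) \<subseteq> im g"
  using im_Comp[OF assms] im_subset[OF assms(1)] assms(3) by (auto simp: im_def)

lemma monic_iff_inj: "monic C f \<longleftrightarrow> f \<in> Arr C \<and> inj_on (act f) (el (Dom C f))"
proof
  assume "f \<in> Arr C \<and> inj_on (act f) (el (Dom C f))"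
  then have f: "f \<in> Arr C" and inj: "inj_on (act f) (el (Dom C f))"
    by simp_all
  have "g = h" if "g \<in> arrow C X (Dom C f)" "h \<in> arrow C X (Dom C f)" "f \<cdot> g = f \<cdot> h" for X g h
  proof (rule faithful)
    fix x assume x: "x \<in> el (Dom C g)"
    have "act f (act g x) = act f (act h x)"
      using that f x act_Comp[of g f x] act_Comp[of h f x] by (auto simp: arrow_def)
    then show "act g x = act h x"
      using inj_onD[OF inj] that x act_el[of g x] act_el[of h x] by (auto simp: arrow_def)
  qed (use that in \<open>auto simp: arrow_def\<close>)
  then show "monic C f"
    unfolding monic_def using f by blast
next
  assume "monic C f"
  then show "f \<in> Arr C \<and> inj_on (act f) (el (Dom C f))"
    using monic_imp_inj[of f] by (simp add: monic_def)
qed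

lemma monic_Arr [simp]: "monic C f \<Longrightarrow> f \<in> Arr C"
  by (simp add: monic_def)

lemma monic_cancel:
  assumes "monic C f" "g \<in> Arr C" "h \<in> Arr C" "Dom C g = Dom C h"
    "Cod C g = Dom C f" "Cod C h = Dom C f" "f \<cdot> g = f \<cdot> h"
  shows "g = h"
proof -
  have "g \<in> arrow C (Dom C h) (Dom C f)" "h \<in> arrow C (Dom C h) (Dom C f)" "Dom C h \<in> Obj C"
    using assms Dom_Obj by (auto simp: arrow_def)
  then show ?thesis
    using assms(1,7) unfolding monic_def by blast
qed

lemma inj_act_Comp:
  assumes "f \<in> Arr C" "g \<in> Arr C" "Cod C f = Dom C g"
  shows "inj_on (act (g \<cdot> f)) (el (Dom C f)) \<longleftrightarrow> inj_on (act g \<circ> act f) (el (Dom C f))"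
  by (rule inj_on_cong) (simp add: act_Comp assms)

lemma monic_Comp:
  assumes "monic C f" "monic C g" "Cod C f = Dom C g"
  shows "monic C (g \<cdot> f)"
proof -
  have "act f ` el (Dom C f) \<subseteq> el (Dom C g)"
    using act_in_el[of f] assms by auto
  then have "inj_on (act g \<circ> act f) (el (Dom C f))"
    using assms(1,2) unfolding monic_iff_inj by (blast intro: comp_inj_on inj_on_subset)
  then show ?thesis
    using assms by (simp add: monic_iff_inj inj_act_Comp)
qed

lemma monic_right_factor:
  assumes "monic C (g \<cdot> f)" "f \<in> Arr C" "g \<in> Arr C" "Cod C f = Dom C g"
  shows "monic C f"
proof -
  have "inj_on (act g \<circ> act f) (el (Dom C f))"
    using assms by (simp add: monic_iff_inj inj_act_Comp)
  then have "inj_on (act f) (el (Dom C f))"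
    by (rule inj_on_imageI2)
  then show ?thesis
    using assms(2) by (simp add: monic_iff_inj)
qed

lemma monic_factor:
  assumes "f \<in> Arr C" "monic C m" "Cod C f = Cod C m"
  shows "im f \<subseteq> im m \<longleftrightarrow> (\<exists>t \<in> Arr C. Dom C t = Dom C f \<and> Cod C t = Dom C m \<and> m \<cdot> t = f)"
proof
  assume "im f \<subseteq> im m"
  then have "\<exists>t \<in> arrow C (Dom C f) (Dom C m). f = m \<cdot> t"
    using factor[of f m] assms by (simp add: monic_iff_inj)
  then show "\<exists>t \<in> Arr C. Dom C t = Dom C f \<and> Cod C t = Dom C m \<and> m \<cdot> t = f"
    by (auto simp: arrow_def)
next
  assume "\<exists>t \<in> Arr C. Dom C t = Dom C f \<and> Cod C t = Dom C m \<and> m \<cdot> t = f"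
  then obtain t where "t \<in> Arr C" "Cod C t = Dom C m" "m \<cdot> t = f"
    by blast
  then show "im f \<subseteq> im m"
    using im_Comp_subset[of t m] assms(2) by simp
qed

lemma iso_monic:
  assumes "iso C i"
  shows "monic C i"
proof -
  obtain j where "i \<in> Arr C" "j \<in> Arr C" "Dom C j = Cod C i" "j \<cdot> i = Ident C (Dom C i)"
    using assms by (auto simp: iso_def arrow_def)
  moreover have "monic C (Ident C X)" if "X \<in> Obj C" for X
    using that by (auto simp: monic_iff_inj inj_on_def act_Ident)
  ultimately show ?thesis
    using monic_right_factor[of j i] Dom_Obj[of i] by simp
qed

lemma iso_Ident: "X \<in> Obj C \<Longrightarrow> iso C (Ident C X)"
  by (auto simp: iso_def intro!: bexI[of _ "Ident C X"] Ident_arrow)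

lemma iso_surj:
  assumes "iso C i" "x \<in> Arr C" "Cod C x = Cod C i"
  shows "\<exists>y \<in> Arr C. Cod C y = Dom C i \<and> Dom C y = Dom C x \<and> i \<cdot> y = x"
proof -
  obtain j where j: "i \<in> Arr C" "j \<in> Arr C" "Dom C j = Cod C i" "Cod C j = Dom C i"
      "i \<cdot> j = Ident C (Cod C i)"
    using assms by (auto simp: iso_def arrow_def)
  show ?thesis
    by (rule bexI[of _ "j \<cdot> x"]) (use j assms in \<open>auto simp: assoc\<close>)
qed

lemma im_Comp_iso:
  assumes "iso C i" "f \<in> Arr C" "Cod C i = Dom C f"
  shows "im (f \<cdot> i) = im f"
proof
  have i: "i \<in> Arr C"
    using assms by (simp add: iso_def)
  obtain j where j: "j \<in> Arr C" "Cod C j = Dom C i" "Dom C j = Dom C f" "i \<cdot> j = Ident C (Dom C f)"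
    using iso_surj[OF assms(1), of "Ident C (Dom C f)"] Dom_Obj[of f] assms by auto
  then have "f = (f \<cdot> i) \<cdot> j"
    using assms i by (simp flip: assoc)
  then show "im f \<subseteq> im (f \<cdot> i)"
    by (metis Comp_simps(1,2) assms(2,3) i j(1,2) im_Comp_subset)
  show "im (f \<cdot> i) \<subseteq> im f"
    using assms i im_Comp_subset by simp
qed


section \<open>Subobjects as sets of elements\<close>

lemma sub_classE:
  assumes "a' \<in> sub_class C a" "monic C a"
  shows "monic C a'" "Cod C a' = Cod C a" "im a' = im a"
  using assms iso_monic monic_Comp im_Comp_iso by (auto simp: sub_class_def)

lemma sub_class_self: "a \<in> Arr C \<Longrightarrow> a \<in> sub_class C a"
  using iso_Ident[OF Dom_Obj, of a] Dom_Obj[of a]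
  by (auto simp: sub_class_def intro!: exI[of _ "Ident C (Dom C a)"])

text \<open>Two monomorphisms with the same image factor through each other, and the two factors are
  mutually inverse because monomorphisms cancel. So a subobject is determined by its image.\<close>
lemma sub_class_eqI:
  assumes "monic C a" "monic C b" "Cod C a = Cod C b" "im a = im b"
  shows "sub_class C a = sub_class C b"
proof -
  have *: "sub_class C b \<subseteq> sub_class C a"
    if mon: "monic C a" "monic C b" "Cod C a = Cod C b" "im a = im b" for a b
  proof
    fix c assume "c \<in> sub_class C b"
    from sub_classE[OF this] mon have c: "monic C c" "Cod C c = Cod C a" "im c = im a"
      by auto
    obtain s where s: "s \<in> Arr C" "Dom C s = Dom C c" "Cod C s = Dom C a" "a \<cdot> s = c"
      using monic_factor[of c a] c mon(1) by auto
    obtain t where t: "t \<in> Arr C" "Dom C t = Dom C a" "Cod C t = Dom C c" "c \<cdot> t = a"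
      using monic_factor[of a c] c mon(1) by auto
    have "s \<cdot> t = Ident C (Dom C a)"
    proof (rule monic_cancel[OF mon(1)])
      show "a \<cdot> (s \<cdot> t) = a \<cdot> Ident C (Dom C a)"
        using s t c mon(1) assoc[of t s a] by simp
    qed (use s t c mon(1) Dom_Obj[of a] in auto)
    moreover have "t \<cdot> s = Ident C (Dom C c)"
    proof (rule monic_cancel[OF c(1)])
      show "c \<cdot> (t \<cdot> s) = c \<cdot> Ident C (Dom C c)"
        using s t c mon(1) assoc[of s t c] by simp
    qed (use s t c mon(1) Dom_Obj[of c] in auto)
    ultimately have "iso C s"
      using s t by (auto simp: iso_def arrow_def)
    then show "c \<in> sub_class C a"
      using s by (auto simp: sub_class_def)
  qed
  show ?thesis
    using *[of a b] *[of b a] assms by auto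
qed

lemma Sub_carrierE:
  assumes "A \<in> carrier (Sub C X)"
  obtains a where "monic C a" "Cod C a = X" "A = sub_class C a"
  using assms by (auto simp: Sub_def)

lemma Sub_carrierI [intro]: "monic C a \<Longrightarrow> Cod C a = X \<Longrightarrow> sub_class C a \<in> carrier (Sub C X)"
  by (auto simp: Sub_def)

lemma Sub_le_iff:
  assumes "monic C a" "monic C b" "Cod C a = Cod C b"
  shows "sub_class C a \<sqsubseteq>\<^bsub>Sub C X\<^esub> sub_class C b \<longleftrightarrow> im a \<subseteq> im b"
proof
  assume "sub_class C a \<sqsubseteq>\<^bsub>Sub C X\<^esub> sub_class C b"
  then obtain a' b' f where "a' \<in> sub_class C a" "b' \<in> sub_class C b"
      "f \<in> arrow C (Dom C a') (Dom C b')" "a' = b' \<cdot> f"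
    by (auto simp: Sub_def)
  then show "im a \<subseteq> im b"
    using sub_classE[of a' a] sub_classE[of b' b] assms im_Comp_subset[of f b']
    by (auto simp: arrow_def)
next
  assume "im a \<subseteq> im b"
  then obtain t where "t \<in> Arr C" "Dom C t = Dom C a" "Cod C t = Dom C b" "b \<cdot> t = a"
    using monic_factor[of a b] assms by auto
  then have "a \<in> sub_class C a" "b \<in> sub_class C b" "t \<in> arrow C (Dom C a) (Dom C b)" "a = b \<cdot> t"
    using assms sub_class_self[of a] sub_class_self[of b] by (auto simp: arrow_def)
  then show "sub_class C a \<sqsubseteq>\<^bsub>Sub C X\<^esub> sub_class C b"
    unfolding Sub_def by auto
qed

text \<open>The meet in \<^const>\<open>Sub\<close> is a choice among greatest lower bounds, so it is known only once a
  greatest lower bound exists and is unique; the subobject with the intersected image is one.\<close>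
lemma Sub_meet:
  assumes "monic C a" "Cod C a = X" "monic C b" "Cod C b = X"
  obtains i where "monic C i" "Cod C i = X" "im i = im a \<inter> im b"
    "sub_class C a \<sqinter>\<^bsub>Sub C X\<^esub> sub_class C b = sub_class C i"
proof -
  let ?S = "Sub C X"
  obtain i where i: "monic C i" "Cod C i = X" "im i = im a \<inter> im b"
    using Int_image[of a b] assms by (auto simp: monic_iff_inj)
  have glb: "greatest ?S (sub_class C i) (Lower ?S {sub_class C a, sub_class C b})"
  proof -
    have "Z \<sqsubseteq>\<^bsub>?S\<^esub> sub_class C i"
      if "Z \<in> carrier ?S" "Z \<sqsubseteq>\<^bsub>?S\<^esub> sub_class C a" "Z \<sqsubseteq>\<^bsub>?S\<^esub> sub_class C b" for Z
      using that assms i by (elim Sub_carrierE) (auto simp: Sub_le_iff)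
    then show ?thesis
      using assms i by (auto simp: greatest_def Lower_def Sub_le_iff)
  qed
  have uniq: "Z = sub_class C i"
    if Z: "greatest ?S Z (Lower ?S {sub_class C a, sub_class C b})" for Z
  proof -
    obtain z where z: "monic C z" "Cod C z = X" "Z = sub_class C z"
      using Z by (auto simp: greatest_def Lower_def elim!: Sub_carrierE)
    have "Z \<sqsubseteq>\<^bsub>?S\<^esub> sub_class C i" "sub_class C i \<sqsubseteq>\<^bsub>?S\<^esub> Z"
      using Z glb by (auto simp: greatest_def)
    then have "im z = im i"
      using z i by (auto simp: Sub_le_iff)
    then show "Z = sub_class C i"
      using z i sub_class_eqI[of z i] by simp
  qed
  have "sub_class C a \<sqinter>\<^bsub>?S\<^esub> sub_class C b = sub_class C i"
    unfolding meet_def Lattice.inf_def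
    by (rule some_equality[of "\<lambda>x. greatest ?S x (Lower ?S {sub_class C a, sub_class C b})",
          OF glb uniq])
  then show thesis
    using that i by blast
qed


section \<open>Pushouts along monomorphisms\<close>

text \<open>The universal property is tested against three cocones. The glued cocone \<open>(p, q)\<close> yields \<open>s\<close>
  with \<open>s m = p\<close> and \<open>s d = q\<close>; since \<open>q\<close> is injective, so is \<open>d\<close>, and \<open>s\<close> carries an
  element common to \<open>m\<close> and \<open>d\<close> to one common to \<open>p\<close> and \<open>q\<close>, from where \<open>t\<close> brings it back.
  The cocone into the union \<open>i\<close> of the images of \<open>m\<close> and \<open>d\<close> yields \<open>r\<close>, and \<open>i r\<close> is the identity
  because both are the map induced by \<open>(m, d)\<close> itself; hence \<open>i\<close> is surjective.\<close>
lemma pushout_monic: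
  assumes po: "pushout C l k m d" and l: "monic C l"
  shows "monic C d" and "im m \<inter> im d \<subseteq> im (m \<cdot> l)" and "im m \<union> im d = el (Cod C m)"
proof -
  have types: "l \<in> Arr C" "k \<in> Arr C" "m \<in> Arr C" "d \<in> Arr C" "Dom C l = Dom C k"
      "Dom C m = Cod C l" "Dom C d = Cod C k" "Cod C m = Cod C d" and sq: "m \<cdot> l = d \<cdot> k"
    using po by (auto simp: pushout_def)
  have univ: "\<exists>!t. t \<in> arrow C (Cod C m) X \<and> t \<cdot> m = p \<and> t \<cdot> d = q"
    if "X \<in> Obj C" "p \<in> arrow C (Cod C l) X" "q \<in> arrow C (Cod C k) X" "p \<cdot> l = q \<cdot> k" for X p q
    using po that unfolding pushout_def by blast
  obtain P p q t where pq: "p \<in> arrow C (Cod C l) P" "q \<in> arrow C (Cod C k) P"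
      "t \<in> arrow C P (Cod C m)" "p \<cdot> l = q \<cdot> k" "t \<cdot> p = m" "t \<cdot> q = d"
      "inj_on (act q) (el (Dom C q))" "im p \<inter> im q \<subseteq> im (p \<cdot> l)"
    using glue[of l k m d] types sq l by (auto simp: monic_iff_inj)
  have "P \<in> Obj C"
    using Cod_Obj[of p] pq by (auto simp: arrow_def)
  from univ[OF this pq(1,2,4)] obtain s where
    s: "s \<in> arrow C (Cod C m) P" "s \<cdot> m = p" "s \<cdot> d = q"
    by auto
  have arr: "p \<in> Arr C" "Dom C p = Cod C l" "Cod C p = P" "q \<in> Arr C" "Dom C q = Cod C k"
      "Cod C q = P" "t \<in> Arr C" "Dom C t = P" "s \<in> Arr C" "Dom C s = Cod C m" "Cod C s = P"
    using pq s by (auto simp: arrow_def)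
  show "monic C d"
  proof (rule monic_right_factor[of s])
    show "monic C (s \<cdot> d)"
      using s pq arr by (simp add: monic_iff_inj)
  qed (use types arr in auto)
  show "im m \<inter> im d \<subseteq> im (m \<cdot> l)"
  proof
    fix x assume "x \<in> im m \<inter> im d"
    then have "act s x \<in> im p \<inter> im q"
      unfolding s(2,3)[symmetric] using types arr by (auto simp: im_Comp)
    then have "act s x \<in> im (p \<cdot> l)"
      using pq by auto
    then have "act t (act s x) \<in> im (t \<cdot> (p \<cdot> l))"
      using types arr by (simp add: im_Comp)
    moreover have "t \<cdot> (p \<cdot> l) = m \<cdot> l"
      using assoc[of l p t] types arr pq(5) by simp
    moreover have "act t (act s x) = x"
    proof -
      obtain y where y: "y \<in> el (Dom C m)" "x = act m y"
        using \<open>x \<in> im m \<inter> im d\<close> by (auto simp: im_def)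
      then have "act s x = act p y"
        using act_Comp[of m s y] s(2) types arr by simp
      then show ?thesis
        using act_Comp[of p t y] pq(5) types arr y by simp
    qed
    ultimately show "x \<in> im (m \<cdot> l)"
      by simp
  qed
  show "im m \<union> im d = el (Cod C m)"
  proof
    show "im m \<union> im d \<subseteq> el (Cod C m)"
      using im_subset[of m] im_subset[of d] types by auto
    obtain i where i: "i \<in> Arr C" "Cod C i = Cod C m" "monic C i" "im i = im m \<union> im d"
      using Un_image[of m d] types by (auto simp: monic_iff_inj)
    obtain m' where m': "m' \<in> Arr C" "Dom C m' = Cod C l" "Cod C m' = Dom C i" "i \<cdot> m' = m"
      using monic_factor[of m i] i types by auto
    obtain d' where d': "d' \<in> Arr C" "Dom C d' = Cod C k" "Cod C d' = Dom C i" "i \<cdot> d' = d"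
      using monic_factor[of d i] i types by auto
    have "m' \<cdot> l = d' \<cdot> k"
      by (rule monic_cancel[OF i(3)]) (use types i m' d' sq in \<open>auto simp: assoc\<close>)
    then obtain r where r: "r \<in> arrow C (Cod C m) (Dom C i)" "r \<cdot> m = m'" "r \<cdot> d = d'"
      using univ[of "Dom C i" m' d'] m' d' i Dom_Obj[of i] by (auto simp: arrow_def)
    have "\<exists>!t. t \<in> arrow C (Cod C m) (Cod C m) \<and> t \<cdot> m = m \<and> t \<cdot> d = d"
      using univ[of "Cod C m" m d] types sq Cod_Obj[of m] by (auto simp: arrow_def)
    moreover have "i \<cdot> r \<in> arrow C (Cod C m) (Cod C m)" "(i \<cdot> r) \<cdot> m = m" "(i \<cdot> r) \<cdot> d = d"
      using r m' d' i types by (auto simp: arrow_def assoc[symmetric])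
    moreover have "Ident C (Cod C m) \<in> arrow C (Cod C m) (Cod C m)" "Ident C (Cod C m) \<cdot> m = m"
        "Ident C (Cod C m) \<cdot> d = d"
      using types Cod_Obj[of m] by (auto intro: Ident_arrow)
    ultimately have ir: "i \<cdot> r = Ident C (Cod C m)"
      by blast
    show "el (Cod C m) \<subseteq> im m \<union> im d"
    proof
      fix x assume x: "x \<in> el (Cod C m)"
      then have "x = act (i \<cdot> r) x"
        using ir types Cod_Obj[of m] by (simp add: act_Ident)
      also have "\<dots> = act i (act r x)"
        using x r i by (intro act_Comp) (auto simp: arrow_def)
      also have "\<dots> \<in> im i"
        using x r act_el[of r x] by (auto simp: im_def arrow_def)
      finally show "x \<in> im m \<union> im d"
        using i by simp
    qed
  qed
qed


section \<open>Transport along one derivation\<close>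

lemma direct_derivationE:
  assumes "direct_derivation C G \<rho> H"
  shows "monic C (dleg \<rho>)" "monic C (hleg \<rho>)" "Dom C (hleg \<rho>) = Dom C (dleg \<rho>)"
    "Cod C (dleg \<rho>) = G" "Cod C (hleg \<rho>) = H"
    "monic C (mtch \<rho>)" "Cod C (mtch \<rho>) = G" "monic C (mtch \<rho> \<cdot> lft \<rho>)"
    "Cod C (mtch \<rho> \<cdot> lft \<rho>) = G"
    "im (mtch \<rho>) \<union> im (dleg \<rho>) = el G" "im (mtch \<rho>) \<inter> im (dleg \<rho>) = im (mtch \<rho> \<cdot> lft \<rho>)"
proof -
  have rule: "monic C (lft \<rho>)" "monic C (rgt \<rho>)" "monic C (mtch \<rho>)" "Cod C (mtch \<rho>) = G"
      "Dom C (mtch \<rho>) = Cod C (lft \<rho>)" "Cod C (comatch \<rho>) = H"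
    and po: "pushout C (lft \<rho>) (kctx \<rho>) (mtch \<rho>) (dleg \<rho>)"
      "pushout C (rgt \<rho>) (kctx \<rho>) (comatch \<rho>) (hleg \<rho>)"
    using assms by (auto simp: direct_derivation_def linear_rule_def)
  have types: "kctx \<rho> \<in> Arr C" "dleg \<rho> \<in> Arr C" "hleg \<rho> \<in> Arr C" "Cod C (kctx \<rho>) = Dom C (dleg \<rho>)"
      "mtch \<rho> \<cdot> lft \<rho> = dleg \<rho> \<cdot> kctx \<rho>"
    using po by (auto simp: pushout_def)
  show "monic C (mtch \<rho> \<cdot> lft \<rho>)" "Cod C (mtch \<rho> \<cdot> lft \<rho>) = G"
    using rule monic_Comp by auto
  show "Dom C (hleg \<rho>) = Dom C (dleg \<rho>)" "Cod C (dleg \<rho>) = G" "Cod C (hleg \<rho>) = H"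
      "monic C (mtch \<rho>)" "Cod C (mtch \<rho>) = G"
    using po rule by (auto simp: pushout_def)
  note L = pushout_monic[OF po(1) rule(1)] and R = pushout_monic[OF po(2) rule(2)]
  show "monic C (dleg \<rho>)" "monic C (hleg \<rho>)" "im (mtch \<rho>) \<union> im (dleg \<rho>) = el G"
    using L R rule by auto
  show "im (mtch \<rho>) \<inter> im (dleg \<rho>) = im (mtch \<rho> \<cdot> lft \<rho>)"
    using L(2) im_Comp_subset[of "lft \<rho>" "mtch \<rho>"] im_Comp_subset[of "kctx \<rho>" "dleg \<rho>"] types rule
    by auto
qed

text \<open>Elements of \<open>G\<close> outside the context lie in the match and not in the interface, so a
  subobject meets the match only in the interface iff it avoids them.\<close>
lemma stable_iff:
  assumes der: "direct_derivation C G \<rho> H" and a: "monic C a" "Cod C a = G"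
  shows "stable C \<rho> (sub_class C a) \<longleftrightarrow> im a \<subseteq> im (dleg \<rho>)"
proof -
  note D = direct_derivationE[OF der]
  obtain i where i: "monic C i" "Cod C i = G" "im i = im a \<inter> im (mtch \<rho>)"
      "sub_class C a \<sqinter>\<^bsub>Sub C G\<^esub> sub_class C (mtch \<rho>) = sub_class C i"
    using Sub_meet[OF a D(6,7)] by metis
  have "stable C \<rho> (sub_class C a) \<longleftrightarrow> im a \<inter> im (mtch \<rho>) \<subseteq> im (mtch \<rho> \<cdot> lft \<rho>)"
    using a i D by (auto simp: stable_def Let_def Sub_le_iff)
  also have "\<dots> \<longleftrightarrow> im a \<subseteq> im (dleg \<rho>)"
    using im_subset[of a] a D(10,11) by auto
  finally show ?thesis .
qed

text \<open>The subobject \<open>h a'\<close> does not depend on the chosen representative \<open>d a'\<close>: as \<open>d\<close> is injective, the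
  image of \<open>d a'\<close> determines that of \<open>a'\<close>.\<close>
lemma transport_eq:
  assumes der: "direct_derivation C G \<rho> H" and a: "monic C a" "Cod C a = Dom C (dleg \<rho>)"
  shows "transport C \<rho> (sub_class C (dleg \<rho> \<cdot> a)) = sub_class C (hleg \<rho> \<cdot> a)"
  unfolding transport_def
proof (rule the_equality)
  note D = direct_derivationE[OF der]
  show "\<exists>a' \<in> Arr C. Cod C a' = Dom C (dleg \<rho>) \<and>
      dleg \<rho> \<cdot> a' \<in> sub_class C (dleg \<rho> \<cdot> a) \<and> sub_class C (hleg \<rho> \<cdot> a) = sub_class C (hleg \<rho> \<cdot> a')"
    using a D sub_class_self[of "dleg \<rho> \<cdot> a"] by auto
  fix B
  assume "\<exists>a' \<in> Arr C. Cod C a' = Dom C (dleg \<rho>) \<and>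
      dleg \<rho> \<cdot> a' \<in> sub_class C (dleg \<rho> \<cdot> a) \<and> B = sub_class C (hleg \<rho> \<cdot> a')"
  then obtain a' where a': "a' \<in> Arr C" "Cod C a' = Dom C (dleg \<rho>)"
      "dleg \<rho> \<cdot> a' \<in> sub_class C (dleg \<rho> \<cdot> a)" "B = sub_class C (hleg \<rho> \<cdot> a')"
    by auto
  note a'' = sub_classE[OF a'(3) monic_Comp[OF a(1) D(1) a(2)]]
  then have "act (dleg \<rho>) ` im a' = act (dleg \<rho>) ` im a"
    using a a' D by (simp add: im_Comp)
  then have "im a' = im a"
    using inj_on_image_eq_iff[OF monic_imp_inj[OF D(1)], of "im a'" "im a"]
      im_subset[of a'] im_subset[of a] a a' by simp
  moreover have "monic C a'"
    using a' a'' D monic_right_factor[of "dleg \<rho>" a'] by simp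
  ultimately show "B = sub_class C (hleg \<rho> \<cdot> a)"
    unfolding a'(4) using a a' D by (intro sub_class_eqI monic_Comp) (auto simp: im_Comp)
qed


section \<open>Transport along a path\<close>

lemma derivation_path_snoc:
  "derivation_path C G (\<pi> @ [\<rho>]) G' \<longleftrightarrow>
     (\<exists>H. derivation_path C G \<pi> H \<and> direct_derivation C H \<rho> G')"
proof (induction \<pi> arbitrary: G)
  case Nil
  have "G \<in> Obj C" "G' \<in> Obj C" if "direct_derivation C G \<rho> G'"
    using direct_derivationE[OF that] Cod_Obj[of "dleg \<rho>"] Cod_Obj[of "hleg \<rho>"] by auto
  then show ?case
    by auto
qed auto

lemma transports_intact_snoc:
  "transports_intact C (\<pi> @ [\<rho>]) A \<longleftrightarrow>
     transports_intact C \<pi> A \<and> stable C \<rho> (fold (transport C) \<pi> A)"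
  by (induction \<pi> arbitrary: A) auto

lemma trk_path_snoc: "trk_path C G (\<pi> @ [\<rho>]) = trk C \<rho> \<cdot>\<^bsub>Par C\<^esub> trk_path C G \<pi>"
  by (simp add: trk_path_def)

lemma reps_Par_Comp:
  "reps (t \<cdot>\<^bsub>Par C\<^esub> s) = {(u \<cdot> p \<cdot> j, z \<cdot> q \<cdot> j) | u v w z p q j.
     (u, v) \<in> reps s \<and> (w, z) \<in> reps t \<and> pullback C v w p q \<and> iso C j \<and> Cod C j = Dom C (u \<cdot> p)}"
  by (auto simp: reps_def Par_def span_class_def) blast+

lemma reps_trk: "reps (trk C \<rho>) = {(dleg \<rho> \<cdot> i, hleg \<rho> \<cdot> i) | i. iso C i \<and> Cod C i = Dom C (dleg \<rho>)}"
  by (auto simp: reps_def trk_def span_class_def)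

text \<open>Transport along a derivation may be computed with any representative of its track, not only with
  the legs of the derivation.\<close>
lemma reps_trkE:
  assumes der: "direct_derivation C G \<rho> H" and wz: "(w, z) \<in> reps (trk C \<rho>)"
  shows "monic C w" "monic C z" "Dom C w = Dom C z" "Cod C w = G" "Cod C z = H"
    "im w = im (dleg \<rho>)"
    "\<lbrakk>monic C y; Cod C y = Dom C w\<rbrakk>
      \<Longrightarrow> transport C \<rho> (sub_class C (w \<cdot> y)) = sub_class C (z \<cdot> y)"
proof -
  note D = direct_derivationE[OF der]
  obtain i where i: "iso C i" "Cod C i = Dom C (dleg \<rho>)" "w = dleg \<rho> \<cdot> i" "z = hleg \<rho> \<cdot> i"
    using wz by (auto simp: reps_trk)
  note mon = iso_monic[OF i(1)]
  show "monic C w" "monic C z" "Dom C w = Dom C z" "Cod C w = G" "Cod C z = H"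
    "im w = im (dleg \<rho>)"
    using i D mon by (simp_all add: monic_Comp im_Comp_iso)
  assume y: "monic C y" "Cod C y = Dom C w"
  then have "Cod C y = Dom C i"
    using i D mon by simp
  then show "transport C \<rho> (sub_class C (w \<cdot> y)) = sub_class C (z \<cdot> y)"
    using transport_eq[OF der, of "i \<cdot> y"] i D mon y
    by (simp add: monic_Comp flip: assoc)
qed

text \<open>The last clause is what a pullback along \<open>w\<close> means for subobjects: \<open>p\<close> is the preimage of \<open>w\<close>
  under \<open>v\<close>.\<close>
lemma pullback_monic:
  assumes pb: "pullback C v w p q" and v: "monic C v" and w: "monic C w"
  shows "monic C p" "monic C q" "Cod C p = Dom C v" "Cod C q = Dom C w" "Dom C p = Dom C q"
    "v \<cdot> p = w \<cdot> q"
    "\<lbrakk>b \<in> Arr C; Cod C b = Dom C v\<rbrakk> \<Longrightarrow> im (v \<cdot> b) \<subseteq> im w \<longleftrightarrow> im b \<subseteq> im p"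
proof -
  have types: "p \<in> Arr C" "q \<in> Arr C" "Cod C p = Dom C v" "Cod C q = Dom C w" "Dom C p = Dom C q"
      "Cod C v = Cod C w" and sq: "v \<cdot> p = w \<cdot> q"
    and univ: "\<And>X p' q'. \<lbrakk>X \<in> Obj C; p' \<in> arrow C X (Dom C v); q' \<in> arrow C X (Dom C w);
        v \<cdot> p' = w \<cdot> q'\<rbrakk> \<Longrightarrow> \<exists>!t. t \<in> arrow C X (Dom C p) \<and> p \<cdot> t = p' \<and> q \<cdot> t = q'"
    using pb unfolding pullback_def by blast+
  \<comment> \<open>Equality after \<open>p\<close> gives equality after \<open>q\<close>, and conversely, since \<open>v\<close> and \<open>w\<close> cancel; so either
    suffices for the uniqueness part of the universal property.\<close>
  have cancel: "g = h"
    if g: "g \<in> arrow C X (Dom C p)" and h: "h \<in> arrow C X (Dom C p)"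
      and eq: "p \<cdot> g = p \<cdot> h \<or> q \<cdot> g = q \<cdot> h" and X: "X \<in> Obj C" for X g h
  proof -
    have t: "g \<in> Arr C" "h \<in> Arr C" "Dom C g = X" "Dom C h = X" "Cod C g = Dom C q" "Cod C h = Dom C q"
      using g h types by (auto simp: arrow_def)
    have comm: "v \<cdot> (p \<cdot> g) = w \<cdot> (q \<cdot> g)" "v \<cdot> (p \<cdot> h) = w \<cdot> (q \<cdot> h)"
      using t types sq v w by (simp_all add: assoc)
    have "p \<cdot> g = p \<cdot> h"
    proof (rule disjE[OF eq])
      assume "q \<cdot> g = q \<cdot> h"
      then have "v \<cdot> (p \<cdot> g) = v \<cdot> (p \<cdot> h)"
        using comm by simp
      then show ?thesis
        by (rule monic_cancel[OF v, rotated -1]) (use t types in simp_all)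
    qed
    moreover have "q \<cdot> g = q \<cdot> h"
    proof (rule disjE[OF eq])
      assume "p \<cdot> g = p \<cdot> h"
      then have "w \<cdot> (q \<cdot> g) = w \<cdot> (q \<cdot> h)"
        using comm by simp
      then show ?thesis
        by (rule monic_cancel[OF w, rotated -1]) (use t types in simp_all)
    qed
    moreover have "p \<cdot> g \<in> arrow C X (Dom C v)" "q \<cdot> g \<in> arrow C X (Dom C w)"
      using t types by (auto simp: arrow_def)
    ultimately show "g = h"
      using univ[OF X _ _ comm(1)] g h by metis
  qed
  show "monic C p" "monic C q"
    unfolding monic_def using types cancel by metis+
  show "Cod C p = Dom C v" "Cod C q = Dom C w" "Dom C p = Dom C q" "v \<cdot> p = w \<cdot> q"
    by fact+
  assume b: "b \<in> Arr C" "Cod C b = Dom C v"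
  show "im (v \<cdot> b) \<subseteq> im w \<longleftrightarrow> im b \<subseteq> im p"
  proof
    assume "im (v \<cdot> b) \<subseteq> im w"
    then obtain y where y: "y \<in> Arr C" "Dom C y = Dom C b" "Cod C y = Dom C w" "w \<cdot> y = v \<cdot> b"
      using monic_factor[of "v \<cdot> b" w] b v w types by auto
    have "\<exists>!t. t \<in> arrow C (Dom C b) (Dom C p) \<and> p \<cdot> t = b \<and> q \<cdot> t = y"
      by (rule univ) (use y b Dom_Obj[of b] in \<open>auto simp: arrow_def\<close>)
    then obtain t where "t \<in> Arr C" "Cod C t = Dom C p" "p \<cdot> t = b"
      unfolding arrow_def by blast
    then show "im b \<subseteq> im p"
      using im_Comp_subset[of t p] types by simp
  next
    assume "im b \<subseteq> im p"
    then have "im (v \<cdot> b) \<subseteq> im (v \<cdot> p)"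
      using b v types by (auto simp: im_Comp)
    also have "\<dots> \<subseteq> im w"
      using sq types w im_Comp_subset[of q w] by simp
    finally show "im (v \<cdot> b) \<subseteq> im w" .
  qed
qed

text \<open>The induction hypothesis on a pair of legs \<open>(u, v)\<close> for the path \<open>\<pi>\<close>: transport along \<open>\<pi>\<close> moves
  the subobjects below \<open>u\<close> in the way \<open>(u, v)\<close> does, and these are exactly the subobjects that are
  transported intact. The first part is what the next step of the path needs.\<close>
definition tracks :: "'o \<Rightarrow> 'm derivation list \<Rightarrow> 'o \<Rightarrow> 'm \<Rightarrow> 'm \<Rightarrow> bool" where
  "tracks G \<pi> G' u v \<longleftrightarrow>
     monic C u \<and> monic C v \<and> Dom C u = Dom C v \<and> Cod C u = G \<and> Cod C v = G' \<and>
     (\<forall>x. monic C x \<and> Cod C x = Dom C u \<longrightarrow>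
        fold (transport C) \<pi> (sub_class C (u \<cdot> x)) = sub_class C (v \<cdot> x)) \<and>
     (\<forall>a. monic C a \<and> Cod C a = G \<longrightarrow>
        transports_intact C \<pi> (sub_class C a) \<longleftrightarrow> im a \<subseteq> im u)"

lemma tracks_Nil:
  assumes "iso C i" "Cod C i = G"
  shows "tracks G [] G i i"
proof -
  have "im i = el G"
    using assms im_Comp_iso[of i "Ident C G"] iso_monic[of i] Cod_Obj[of i] act_Ident[of G]
    by (force simp: im_def)
  moreover have "im a \<subseteq> el G" if "monic C a" "Cod C a = G" for a
    using that im_subset[of a] by simp
  ultimately show ?thesis
    unfolding tracks_def using assms iso_monic[of i] by simp
qed

lemma tracks_snoc:
  assumes uv: "tracks G \<pi> H u v" and der: "direct_derivation C H \<rho> G'"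
    and wz: "(w, z) \<in> reps (trk C \<rho>)" and pb: "pullback C v w p q"
    and j: "iso C j" "Cod C j = Dom C (u \<cdot> p)"
  shows "tracks G (\<pi> @ [\<rho>]) G' (u \<cdot> p \<cdot> j) (z \<cdot> q \<cdot> j)"
proof -
  have u: "monic C u" "monic C v" "Dom C u = Dom C v" "Cod C u = G" "Cod C v = H"
    and fold_u: "\<And>x. \<lbrakk>monic C x; Cod C x = Dom C v\<rbrakk>
      \<Longrightarrow> fold (transport C) \<pi> (sub_class C (u \<cdot> x)) = sub_class C (v \<cdot> x)"
    and intact_u: "\<And>a. \<lbrakk>monic C a; Cod C a = G\<rbrakk>
      \<Longrightarrow> transports_intact C \<pi> (sub_class C a) \<longleftrightarrow> im a \<subseteq> im u"
    using uv by (auto simp: tracks_def)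
  note W = reps_trkE[OF der wz]
  note P = pullback_monic[OF pb u(2) W(1)]
  have jm: "monic C j" "Cod C j = Dom C q"
    using j iso_monic u P by auto
  have mon: "monic C (u \<cdot> p \<cdot> j)" "monic C (z \<cdot> q \<cdot> j)"
    using u W P jm by (simp_all add: monic_Comp)
  have im_eq: "im (u \<cdot> p \<cdot> j) = im (u \<cdot> p)"
    using im_Comp_iso j u P by simp
  have "fold (transport C) (\<pi> @ [\<rho>]) (sub_class C (u \<cdot> p \<cdot> j \<cdot> x)) = sub_class C (z \<cdot> q \<cdot> j \<cdot> x)"
    if x: "monic C x" "Cod C x = Dom C j" for x
  proof -
    have "fold (transport C) (\<pi> @ [\<rho>]) (sub_class C (u \<cdot> p \<cdot> j \<cdot> x))
        = transport C \<rho> (fold (transport C) \<pi> (sub_class C (u \<cdot> (p \<cdot> (j \<cdot> x)))))"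
      using x u P jm by (simp add: assoc)
    also have "\<dots> = transport C \<rho> (sub_class C (v \<cdot> (p \<cdot> (j \<cdot> x))))"
      using x u P jm by (simp add: fold_u monic_Comp)
    also have "v \<cdot> (p \<cdot> (j \<cdot> x)) = w \<cdot> (q \<cdot> (j \<cdot> x))"
      using x u W P jm by (simp add: assoc)
    also have "transport C \<rho> (sub_class C \<dots>) = sub_class C (z \<cdot> (q \<cdot> (j \<cdot> x)))"
      using x W P jm by (simp add: monic_Comp)
    also have "z \<cdot> (q \<cdot> (j \<cdot> x)) = z \<cdot> q \<cdot> j \<cdot> x"
      using x W P jm by (simp add: assoc)
    finally show ?thesis .
  qed
  moreover have "transports_intact C (\<pi> @ [\<rho>]) (sub_class C a) \<longleftrightarrow> im a \<subseteq> im (u \<cdot> p \<cdot> j)"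
    if a: "monic C a" "Cod C a = G" for a
  proof (cases "im a \<subseteq> im u")
    case True
    then obtain b where b: "b \<in> Arr C" "Cod C b = Dom C u" "u \<cdot> b = a"
      using monic_factor[of a u] a u by auto
    then have bm: "monic C b"
      using a u monic_right_factor[of u b] by simp
    have "transports_intact C (\<pi> @ [\<rho>]) (sub_class C a) \<longleftrightarrow> stable C \<rho> (sub_class C (v \<cdot> b))"
      using True a b bm u fold_u[of b] intact_u[of a] by (simp add: transports_intact_snoc)
    also have "\<dots> \<longleftrightarrow> im b \<subseteq> im p"
      using stable_iff[OF der, of "v \<cdot> b"] b bm u W P by (simp add: monic_Comp)
    also have "\<dots> \<longleftrightarrow> im (u \<cdot> b) \<subseteq> im (u \<cdot> p)"
    proof -
      have "im b \<subseteq> el (Dom C u)" "im p \<subseteq> el (Dom C u)" "inj_on (act u) (el (Dom C u))"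
        using b u P im_subset[of b] im_subset[of p] monic_imp_inj[OF u(1)] by auto
      then have "act u ` im b \<subseteq> act u ` im p \<longleftrightarrow> im b \<subseteq> im p"
        unfolding inj_on_def by blast
      then show ?thesis
        using im_Comp[of b u] im_Comp[of p u] b u P by simp
    qed
    finally show ?thesis
      using b im_eq by simp
  next
    case False
    moreover have "im (u \<cdot> p) \<subseteq> im u"
      using im_Comp_subset[of p u] u P by simp
    ultimately show ?thesis
      using a intact_u[of a] im_eq by (auto simp: transports_intact_snoc)
  qed
  ultimately show ?thesis
    unfolding tracks_def using mon u W P jm by simp
qed

text \<open>The composite of partial maps is defined by a union over all representatives and pullbacks. An
  element of it comes from one choice at each step of the path, and the invariant is preserved
  whatever the choice.\<close>
theorem trk_path_tracks:
  assumes "derivation_path C G\<^sub>0 \<pi> G\<^sub>n" "(u, v) \<in> reps (trk_path C G\<^sub>0 \<pi>)"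
  shows "tracks G\<^sub>0 \<pi> G\<^sub>n u v"
  using assms
proof (induction \<pi> arbitrary: G\<^sub>n u v rule: rev_induct)
  case Nil
  then obtain i where "G\<^sub>0 \<in> Obj C" "G\<^sub>n = G\<^sub>0" "iso C i" "Cod C i = G\<^sub>0"
      "u = Ident C G\<^sub>0 \<cdot> i" "v = Ident C G\<^sub>0 \<cdot> i"
    by (auto simp: trk_path_def reps_def Par_def span_class_def)
  then show ?case
    using tracks_Nil[of i G\<^sub>0] iso_monic[of i] by simp
next
  case (snoc \<rho> \<pi>)
  then show ?case
    by (auto simp: derivation_path_snoc trk_path_snoc reps_Par_Comp intro!: tracks_snoc)
qed

theorem transports_intact_iff:
  assumes path: "derivation_path C G\<^sub>0 \<pi> G\<^sub>n" and uv: "(u, v) \<in> reps (trk_path C G\<^sub>0 \<pi>)"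
    and A: "A \<in> carrier (Sub C G\<^sub>0)"
  shows "transports_intact C \<pi> A \<longleftrightarrow> A \<sqsubseteq>\<^bsub>Sub C G\<^sub>0\<^esub> sub_class C u"
proof -
  obtain a where a: "monic C a" "Cod C a = G\<^sub>0" "A = sub_class C a"
    using A by (rule Sub_carrierE)
  then show ?thesis
    using trk_path_tracks[OF path uv] by (simp add: tracks_def Sub_le_iff)
qed

corollary greatest_transport_domain:
  assumes path: "derivation_path C G\<^sub>0 \<pi> G\<^sub>n" and uv: "(u, v) \<in> reps (trk_path C G\<^sub>0 \<pi>)"
  shows "greatest (Sub C G\<^sub>0) (sub_class C u)
    {A \<in> carrier (Sub C G\<^sub>0). transports_intact C \<pi> A}"
proof -
  have u: "monic C u" "Cod C u = G\<^sub>0"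
    using trk_path_tracks[OF path uv] by (auto simp: tracks_def)
  then have "sub_class C u \<in> carrier (Sub C G\<^sub>0)" "sub_class C u \<sqsubseteq>\<^bsub>Sub C G\<^sub>0\<^esub> sub_class C u"
    by (auto simp: Sub_le_iff)
  then show ?thesis
    using transports_intact_iff[OF path uv] by (auto simp: greatest_def)
qed

end


section \<open>Set-valued functors\<close>

type_synonym ('o, 'm, 'a) presheaf = "('o, 'm, 'a set, 'a set_arr) functor_data"
type_synonym ('o, 'm, 'a) presheaf_hom = "('o, 'm, 'a set, 'a set_arr) nat_trans"

abbreviation presheaf_cat :: "('o, 'm) cat \<Rightarrow> (('o, 'm, 'a) presheaf, ('o, 'm, 'a) presheaf_hom) cat"
  where "presheaf_cat A \<equiv> functor_cat A set_cat"

definition app :: "('o, 'm, 'a) presheaf \<Rightarrow> 'm \<Rightarrow> 'a \<Rightarrow> 'a" where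
  "app F f = fst (snd (FArr F f))"

definition component :: "('o, 'm, 'a) presheaf_hom \<Rightarrow> 'o \<Rightarrow> 'a \<Rightarrow> 'a" where
  "component \<eta> X = fst (snd (fst (snd \<eta>) X))"

definition elements :: "('o, 'm) cat \<Rightarrow> ('o, 'm, 'a) presheaf \<Rightarrow> ('o \<times> 'a) set" where
  "elements A F = Sigma (Obj A) (FObj F)"

definition on_elements :: "('o, 'm, 'a) presheaf_hom \<Rightarrow> 'o \<times> 'a \<Rightarrow> 'o \<times> 'a" where
  "on_elements \<eta> = (\<lambda>(X, x). (X, component \<eta> X x))"

lemma set_cat_arrow_iff: "t \<in> arrow set_cat S T \<longleftrightarrow> (\<exists>f \<in> S \<rightarrow>\<^sub>E T. t = (S, f, T))"
  by (cases t) (auto simp: arrow_def set_cat_def)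

context
  fixes A :: "('o, 'm) cat" (structure)
  assumes precategory_A: "precategory A"
begin

interpretation A: precategory A
  by (rule precategory_A)

lemma app_simps:
  assumes F: "is_functor A set_cat F"
  shows "f \<in> Arr A \<Longrightarrow> FArr F f = (FObj F (Dom A f), app F f, FObj F (Cod A f))"
    and "f \<in> Arr A \<Longrightarrow> app F f \<in> FObj F (Dom A f) \<rightarrow>\<^sub>E FObj F (Cod A f)"
    and "\<lbrakk>f \<in> Arr A; x \<in> FObj F (Dom A f)\<rbrakk> \<Longrightarrow> app F f x \<in> FObj F (Cod A f)"
    and "\<lbrakk>X \<in> Obj A; x \<in> FObj F X\<rbrakk> \<Longrightarrow> app F (Ident A X) x = x"
    and "\<lbrakk>f \<in> Arr A; g \<in> Arr A; Cod A f = Dom A g; x \<in> FObj F (Dom A f)\<rbrakk>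
      \<Longrightarrow> app F (g \<cdot> f) x = app F g (app F f x)"
proof -
  have arr: "FArr F f = (FObj F (Dom A f), app F f, FObj F (Cod A f)) \<and>
      app F f \<in> FObj F (Dom A f) \<rightarrow>\<^sub>E FObj F (Cod A f)" if f: "f \<in> Arr A" for f
  proof -
    have "FArr F f \<in> arrow set_cat (FObj F (Dom A f)) (FObj F (Cod A f))"
      using F f by (auto simp: is_functor_def)
    then show ?thesis
      by (auto simp: app_def set_cat_arrow_iff)
  qed
  show "f \<in> Arr A \<Longrightarrow> FArr F f = (FObj F (Dom A f), app F f, FObj F (Cod A f))"
    and app: "f \<in> Arr A \<Longrightarrow> app F f \<in> FObj F (Dom A f) \<rightarrow>\<^sub>E FObj F (Cod A f)"
    using arr by auto
  from app show "\<lbrakk>f \<in> Arr A; x \<in> FObj F (Dom A f)\<rbrakk> \<Longrightarrow> app F f x \<in> FObj F (Cod A f)"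
    by blast
  show "\<lbrakk>X \<in> Obj A; x \<in> FObj F X\<rbrakk> \<Longrightarrow> app F (Ident A X) x = x"
    using F by (simp add: is_functor_def app_def set_cat_def)
  assume fg: "f \<in> Arr A" "g \<in> Arr A" "Cod A f = Dom A g" "x \<in> FObj F (Dom A f)"
  then have "FArr F (g \<cdot> f) = FArr F g \<cdot>\<^bsub>set_cat\<^esub> FArr F f"
    using F by (simp add: is_functor_def)
  then show "app F (g \<cdot> f) x = app F g (app F f x)"
    using arr[OF fg(1)] arr[OF fg(2)] fg(4) unfolding app_def[of F "g \<cdot> f"]
    by (auto simp: set_cat_def compose_def)
qed

text \<open>A functor may be specified by sets and maps over any type \<open>'b\<close> that embeds into \<open>'a\<close>. Subfunctors,
  kernel pairs and glued functors arise in this way, with \<open>'b\<close> being \<open>'a\<close>, \<open>'a \<times> 'a\<close> and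
  \<open>'a + 'a\<close>.\<close>
lemma presheaf_from_action:
  fixes J :: "'b \<Rightarrow> 'a"
  assumes J: "inj J"
    and closed: "\<And>f q. \<lbrakk>f \<in> Arr A; q \<in> Q (Dom A f)\<rbrakk> \<Longrightarrow> \<psi> f q \<in> Q (Cod A f)"
    and ident: "\<And>X q. \<lbrakk>X \<in> Obj A; q \<in> Q X\<rbrakk> \<Longrightarrow> \<psi> (Ident A X) q = q"
    and comp: "\<And>f g q. \<lbrakk>f \<in> Arr A; g \<in> Arr A; Cod A f = Dom A g; q \<in> Q (Dom A f)\<rbrakk>
      \<Longrightarrow> \<psi> (g \<cdot> f) q = \<psi> g (\<psi> f q)"
  obtains F where "is_functor A set_cat F" "\<And>X. X \<in> Obj A \<Longrightarrow> FObj F X = J ` Q X"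
    "\<And>f q. \<lbrakk>f \<in> Arr A; q \<in> Q (Dom A f)\<rbrakk> \<Longrightarrow> app F f (J q) = J (\<psi> f q)"
proof
  define \<phi> where "\<phi> f = restrict (\<lambda>x. J (\<psi> f (inv J x))) (J ` Q (Dom A f))" for f
  let ?F = "\<lparr>FObj = \<lambda>X\<in>Obj A. J ` Q X,
    FArr = \<lambda>f\<in>Arr A. (J ` Q (Dom A f), \<phi> f, J ` Q (Cod A f))\<rparr>"
  have \<phi>: "\<phi> f (J q) = J (\<psi> f q)" if "q \<in> Q (Dom A f)" for f q
    using that J by (auto simp: \<phi>_def)
  have \<phi>_fun: "\<phi> f \<in> J ` Q (Dom A f) \<rightarrow>\<^sub>E J ` Q (Cod A f)" if "f \<in> Arr A" for f
    using that closed[OF that] J by (auto simp: \<phi>_def)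
  have "\<phi> (Ident A X) = (\<lambda>x\<in>J ` Q X. x)" if "X \<in> Obj A" for X
    using that J ident by (auto simp: \<phi>_def fun_eq_iff)
  moreover have "\<phi> (g \<cdot> f) = compose (J ` Q (Dom A f)) (\<phi> g) (\<phi> f)"
    if "f \<in> Arr A" "g \<in> Arr A" "Cod A f = Dom A g" for f g
  proof
    fix x
    show "\<phi> (g \<cdot> f) x = compose (J ` Q (Dom A f)) (\<phi> g) (\<phi> f) x"
    proof (cases "x \<in> J ` Q (Dom A f)")
      case True
      then obtain q where q: "q \<in> Q (Dom A f)" "x = J q"
        by auto
      then show ?thesis
        using that comp closed[OF that(1) q(1)] by (simp add: compose_def \<phi>)
    next
      case False
      then show ?thesis
        using that by (simp add: compose_def \<phi>_def)
    qed
  qed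
  ultimately show "is_functor A set_cat ?F"
    using \<phi>_fun A.Dom_Obj A.Cod_Obj
    by (auto simp: is_functor_def arrow_def set_cat_def)
  show "X \<in> Obj A \<Longrightarrow> FObj ?F X = J ` Q X" for X
    by simp
  show "app ?F f (J q) = J (\<psi> f q)" if "f \<in> Arr A" "q \<in> Q (Dom A f)" for f q
    using that \<phi> by (simp add: app_def)
qed

text \<open>Arrows are triples of triples; this reduces them to families of functions between sets that commute
  with the action, and the last conjunct recovers the arrow from its components.\<close>
lemma presheaf_hom_iff:
  "\<eta> \<in> arrow (presheaf_cat A) F G \<longleftrightarrow>
     is_functor A set_cat F \<and> is_functor A set_cat G \<and>
     (\<forall>X \<in> Obj A. component \<eta> X \<in> FObj F X \<rightarrow>\<^sub>E FObj G X) \<and>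
     (\<forall>f \<in> Arr A. \<forall>x \<in> FObj F (Dom A f).
        component \<eta> (Cod A f) (app F f x) = app G f (component \<eta> (Dom A f) x)) \<and>
     \<eta> = (F, \<lambda>X\<in>Obj A. (FObj F X, component \<eta> X, FObj G X), G)"
  (is "?lhs \<longleftrightarrow> ?rhs")
proof -
  have nat: "\<eta> (Cod A f) \<cdot>\<^bsub>set_cat\<^esub> FArr F f = FArr G f \<cdot>\<^bsub>set_cat\<^esub> \<eta> (Dom A f) \<longleftrightarrow>
      (\<forall>x \<in> FObj F (Dom A f). c (Cod A f) (app F f x) = app G f (c (Dom A f) x))"
    if "f \<in> Arr A" "is_functor A set_cat F" "is_functor A set_cat G"
      "\<And>X. X \<in> Obj A \<Longrightarrow> \<eta> X = (FObj F X, c X, FObj G X)" for \<eta> c f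
    using that(1) app_simps(1)[OF that(2,1)] app_simps(1)[OF that(3,1)]
      that(4)[OF A.Dom_Obj[OF that(1)]] that(4)[OF A.Cod_Obj[OF that(1)]]
    by (auto simp: set_cat_def compose_def restrict_def fun_eq_iff)
  show ?thesis
  proof
    assume ?lhs
    then obtain \<theta> where \<theta>: "\<eta> = (F, \<theta>, G)" "is_nat_trans A set_cat (F, \<theta>, G)"
      by (cases \<eta>) (auto simp: arrow_def functor_cat_def)
    then have \<theta>X: "\<theta> X = (FObj F X, component \<eta> X, FObj G X) \<and>
        component \<eta> X \<in> FObj F X \<rightarrow>\<^sub>E FObj G X" if "X \<in> Obj A" for X
    proof -
      have "\<theta> X \<in> arrow set_cat (FObj F X) (FObj G X)"
        using \<theta>(2) that by (simp add: is_nat_trans_def)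
      then show ?thesis
        using \<theta>(1) by (auto simp: set_cat_arrow_iff component_def)
    qed
    then have "\<theta> = (\<lambda>X\<in>Obj A. (FObj F X, component \<eta> X, FObj G X))"
      using \<theta> by (auto simp: is_nat_trans_def extensional_def fun_eq_iff)
    moreover have F: "is_functor A set_cat F" "is_functor A set_cat G"
      using \<theta> by (auto simp: is_nat_trans_def)
    moreover have "\<forall>f \<in> Arr A. \<forall>x \<in> FObj F (Dom A f).
        component \<eta> (Cod A f) (app F f x) = app G f (component \<eta> (Dom A f) x)"
      using nat[OF _ F, of _ \<theta> "component \<eta>"] \<theta>X \<theta>(2) by (simp add: is_nat_trans_def)
    ultimately show ?rhs
      using \<theta> \<theta>X by simp
  next
    define \<theta> where "\<theta> = (\<lambda>X\<in>Obj A. (FObj F X, component \<eta> X, FObj G X))"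
    assume r: ?rhs
    then have F: "is_functor A set_cat F" "is_functor A set_cat G" and \<eta>: "\<eta> = (F, \<theta>, G)"
      unfolding \<theta>_def by blast+
    have "\<theta> (Cod A f) \<cdot>\<^bsub>set_cat\<^esub> FArr F f = FArr G f \<cdot>\<^bsub>set_cat\<^esub> \<theta> (Dom A f)" if "f \<in> Arr A" for f
      using nat[OF that F, of \<theta> "component \<eta>"] that r by (simp add: \<theta>_def)
    moreover have "\<theta> X \<in> arrow set_cat (FObj F X) (FObj G X)" if "X \<in> Obj A" for X
      using r that by (auto simp: \<theta>_def set_cat_arrow_iff)
    moreover have "\<theta> \<in> extensional (Obj A)"
      by (simp add: \<theta>_def)
    ultimately have "is_nat_trans A set_cat (F, \<theta>, G)"
      using F by (simp add: is_nat_trans_def)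
    then show ?lhs
      using \<eta> by (simp add: arrow_def functor_cat_def)
  qed
qed

lemma presheaf_homI:
  assumes "is_functor A set_cat F" "is_functor A set_cat G"
    and "\<And>X x. \<lbrakk>X \<in> Obj A; x \<in> FObj F X\<rbrakk> \<Longrightarrow> c X x \<in> FObj G X"
    and "\<And>f x. \<lbrakk>f \<in> Arr A; x \<in> FObj F (Dom A f)\<rbrakk>
      \<Longrightarrow> c (Cod A f) (app F f x) = app G f (c (Dom A f) x)"
  obtains \<eta> where "\<eta> \<in> arrow (presheaf_cat A) F G"
    "\<And>X x. \<lbrakk>X \<in> Obj A; x \<in> FObj F X\<rbrakk> \<Longrightarrow> component \<eta> X x = c X x"
proof
  let ?\<eta> = "(F, \<lambda>X\<in>Obj A. (FObj F X, restrict (c X) (FObj F X), FObj G X), G)"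
  have comp: "component ?\<eta> X = restrict (c X) (FObj F X)" if "X \<in> Obj A" for X
    using that by (simp add: component_def)
  then show "\<lbrakk>X \<in> Obj A; x \<in> FObj F X\<rbrakk> \<Longrightarrow> component ?\<eta> X x = c X x" for X x
    by simp
  show "?\<eta> \<in> arrow (presheaf_cat A) F G"
    unfolding presheaf_hom_iff
  proof (intro conjI ballI)
    show "?\<eta> = (F, \<lambda>X\<in>Obj A. (FObj F X, component ?\<eta> X, FObj G X), G)"
      using comp by (auto simp: fun_eq_iff)
  qed (use assms comp app_simps(3)[OF assms(1)] A.Dom_Obj A.Cod_Obj in auto)
qed

lemma presheaf_homD:
  assumes "\<eta> \<in> arrow (presheaf_cat A) F G"
  shows "is_functor A set_cat F" "is_functor A set_cat G"
    and "\<lbrakk>X \<in> Obj A; x \<in> FObj F X\<rbrakk> \<Longrightarrow> component \<eta> X x \<in> FObj G X"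
    and "\<lbrakk>f \<in> Arr A; x \<in> FObj F (Dom A f)\<rbrakk>
      \<Longrightarrow> component \<eta> (Cod A f) (app F f x) = app G f (component \<eta> (Dom A f) x)"
  using assms by (auto simp: presheaf_hom_iff)

lemma presheaf_hom_eqI:
  assumes "\<eta> \<in> arrow (presheaf_cat A) F G" "\<theta> \<in> arrow (presheaf_cat A) F G"
    and eq: "\<And>X x. \<lbrakk>X \<in> Obj A; x \<in> FObj F X\<rbrakk> \<Longrightarrow> component \<eta> X x = component \<theta> X x"
  shows "\<eta> = \<theta>"
proof -
  have "component \<eta> X = component \<theta> X" if "X \<in> Obj A" for X
  proof (rule PiE_ext)
    show "component \<eta> X \<in> FObj F X \<rightarrow>\<^sub>E FObj G X" "component \<theta> X \<in> FObj F X \<rightarrow>\<^sub>E FObj G X"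
      using assms(1,2) that unfolding presheaf_hom_iff by blast+
  qed (use eq that in auto)
  then have "(\<lambda>X\<in>Obj A. (FObj F X, component \<eta> X, FObj G X))
      = (\<lambda>X\<in>Obj A. (FObj F X, component \<theta> X, FObj G X))"
    by (auto simp: fun_eq_iff)
  then show ?thesis
    using assms(1,2) unfolding presheaf_hom_iff by metis
qed

lemma presheaf_Ident:
  assumes "is_functor A set_cat F"
  shows "Ident (presheaf_cat A) F \<in> arrow (presheaf_cat A) F F"
    and "\<lbrakk>X \<in> Obj A; x \<in> FObj F X\<rbrakk> \<Longrightarrow> component (Ident (presheaf_cat A) F) X x = x"
proof -
  obtain \<eta> where \<eta>: "\<eta> \<in> arrow (presheaf_cat A) F F"
      "\<And>X x. \<lbrakk>X \<in> Obj A; x \<in> FObj F X\<rbrakk> \<Longrightarrow> component \<eta> X x = x"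
    by (rule presheaf_homI[of F F "\<lambda>X x. x"]) (use assms in auto)
  have "component \<eta> X = (\<lambda>x\<in>FObj F X. x)" if "X \<in> Obj A" for X
  proof -
    have "component \<eta> X \<in> FObj F X \<rightarrow>\<^sub>E FObj F X"
      using \<eta>(1) that unfolding presheaf_hom_iff by blast
    then show ?thesis
      using \<eta>(2)[OF that] by (auto simp: fun_eq_iff PiE_def extensional_def)
  qed
  then have "(\<lambda>X\<in>Obj A. (FObj F X, component \<eta> X, FObj F X))
      = (\<lambda>X\<in>Obj A. Ident set_cat (FObj F X))"
    by (auto simp: fun_eq_iff set_cat_def)
  then have "Ident (presheaf_cat A) F = \<eta>"
    using \<eta>(1) unfolding presheaf_hom_iff by (simp add: functor_cat_def)
  then show "Ident (presheaf_cat A) F \<in> arrow (presheaf_cat A) F F"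
    and "\<lbrakk>X \<in> Obj A; x \<in> FObj F X\<rbrakk> \<Longrightarrow> component (Ident (presheaf_cat A) F) X x = x"
    using \<eta> by auto
qed

lemma presheaf_Comp:
  assumes \<eta>: "\<eta> \<in> arrow (presheaf_cat A) F G" and \<theta>: "\<theta> \<in> arrow (presheaf_cat A) G H"
  shows "\<theta> \<cdot>\<^bsub>presheaf_cat A\<^esub> \<eta> \<in> arrow (presheaf_cat A) F H"
    and "\<lbrakk>X \<in> Obj A; x \<in> FObj F X\<rbrakk>
      \<Longrightarrow> component (\<theta> \<cdot>\<^bsub>presheaf_cat A\<^esub> \<eta>) X x = component \<theta> X (component \<eta> X x)"
proof -
  have eqs: "\<eta> = (F, \<lambda>X\<in>Obj A. (FObj F X, component \<eta> X, FObj G X), G)"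
      "\<theta> = (G, \<lambda>X\<in>Obj A. (FObj G X, component \<theta> X, FObj H X), H)"
    using \<eta> \<theta> unfolding presheaf_hom_iff by blast+
  have "\<theta> \<cdot>\<^bsub>presheaf_cat A\<^esub> \<eta> = (F, \<lambda>X\<in>Obj A. (FObj F X,
      compose (FObj F X) (component \<theta> X) (component \<eta> X), FObj H X), H)"
    by (subst (1) eqs(1), subst (1) eqs(2))
      (auto simp: functor_cat_def set_cat_def fun_eq_iff)
  moreover from this have comp: "component (\<theta> \<cdot>\<^bsub>presheaf_cat A\<^esub> \<eta>) X
      = compose (FObj F X) (component \<theta> X) (component \<eta> X)" if "X \<in> Obj A" for X
    using that by (simp add: component_def)
  ultimately have eq: "\<theta> \<cdot>\<^bsub>presheaf_cat A\<^esub> \<eta>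
      = (F, \<lambda>X\<in>Obj A. (FObj F X, component (\<theta> \<cdot>\<^bsub>presheaf_cat A\<^esub> \<eta>) X, FObj H X), H)"
    by (auto simp: fun_eq_iff)
  show "\<lbrakk>X \<in> Obj A; x \<in> FObj F X\<rbrakk>
      \<Longrightarrow> component (\<theta> \<cdot>\<^bsub>presheaf_cat A\<^esub> \<eta>) X x = component \<theta> X (component \<eta> X x)"
    using comp by (simp add: compose_def)
  show "\<theta> \<cdot>\<^bsub>presheaf_cat A\<^esub> \<eta> \<in> arrow (presheaf_cat A) F H"
    unfolding presheaf_hom_iff
  proof (intro conjI ballI)
    fix X assume "X \<in> Obj A"
    then show "component (\<theta> \<cdot>\<^bsub>presheaf_cat A\<^esub> \<eta>) X \<in> FObj F X \<rightarrow>\<^sub>E FObj H X"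
      using comp presheaf_homD(3)[OF \<eta>] presheaf_homD(3)[OF \<theta>] by (auto simp: compose_def)
  next
    fix f x assume f: "f \<in> Arr A" "x \<in> FObj F (Dom A f)"
    then have "app F f x \<in> FObj F (Cod A f)" "component \<eta> (Dom A f) x \<in> FObj G (Dom A f)"
      using app_simps(3)[OF presheaf_homD(1)[OF \<eta>]] presheaf_homD(3)[OF \<eta>] A.Dom_Obj by auto
    then show "component (\<theta> \<cdot>\<^bsub>presheaf_cat A\<^esub> \<eta>) (Cod A f) (app F f x)
        = app H f (component (\<theta> \<cdot>\<^bsub>presheaf_cat A\<^esub> \<eta>) (Dom A f) x)"
      using f comp A.Dom_Obj A.Cod_Obj presheaf_homD(4)[OF \<eta>] presheaf_homD(4)[OF \<theta>]
      by (simp add: compose_def)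
  qed (use eq presheaf_homD(1)[OF \<eta>] presheaf_homD(2)[OF \<theta>] in auto)
qed

lemma inj_on_elements:
  "inj_on (on_elements \<eta>) (elements A F) \<longleftrightarrow> (\<forall>X \<in> Obj A. inj_on (component \<eta> X) (FObj F X))"
  by (auto simp: inj_on_def elements_def on_elements_def)

lemma image_on_elements:
  "on_elements \<eta> ` elements A F = (SIGMA X : Obj A. component \<eta> X ` FObj F X)"
  by (auto simp: elements_def on_elements_def image_iff)


section \<open>Limits and colimits of set-valued functors\<close>

lemma subpresheaf:
  fixes F :: "('o, 'm, 'a) presheaf"
  assumes F: "is_functor A set_cat F"
    and sub: "\<And>X. X \<in> Obj A \<Longrightarrow> P X \<subseteq> FObj F X"
    and closed: "\<And>f x. \<lbrakk>f \<in> Arr A; x \<in> P (Dom A f)\<rbrakk> \<Longrightarrow> app F f x \<in> P (Cod A f)"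
  obtains S \<iota> where "\<iota> \<in> arrow (presheaf_cat A) S F"
    "inj_on (on_elements \<iota>) (elements A S)" "on_elements \<iota> ` elements A S = Sigma (Obj A) P"
proof -
  have P: "x \<in> FObj F X" if "X \<in> Obj A" "x \<in> P X" for X x
    using sub that by blast
  obtain S where S: "is_functor A set_cat S" "\<And>X. X \<in> Obj A \<Longrightarrow> FObj S X = P X"
      "\<And>f x. \<lbrakk>f \<in> Arr A; x \<in> P (Dom A f)\<rbrakk> \<Longrightarrow> app S f x = app F f x"
    by (rule presheaf_from_action[of "\<lambda>x. x" P "app F"])
      (use P closed app_simps(4,5)[OF F] A.Dom_Obj in auto)
  obtain \<iota> where \<iota>: "\<iota> \<in> arrow (presheaf_cat A) S F"
      "\<And>X x. \<lbrakk>X \<in> Obj A; x \<in> FObj S X\<rbrakk> \<Longrightarrow> component \<iota> X x = x"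
    by (rule presheaf_homI[of S F "\<lambda>X x. x"]) (use F S P A.Dom_Obj in auto)
  have "inj_on (component \<iota> X) (FObj S X)" if "X \<in> Obj A" for X
    using \<iota>(2)[OF that] by (auto simp: inj_on_def)
  moreover have "component \<iota> X ` FObj S X = P X" if "X \<in> Obj A" for X
    using \<iota>(2)[OF that] S(2)[OF that] by (auto simp: image_iff)
  ultimately show thesis
    using \<iota>(1) by (intro that) (auto simp: inj_on_elements image_on_elements)
qed

lemma presheaf_image_closed:
  assumes "\<eta> \<in> arrow (presheaf_cat A) F G" "f \<in> Arr A" "x \<in> component \<eta> (Dom A f) ` FObj F (Dom A f)"
  shows "app G f x \<in> component \<eta> (Cod A f) ` FObj F (Cod A f)"
proof -
  obtain z where z: "z \<in> FObj F (Dom A f)" "x = component \<eta> (Dom A f) z"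
    using assms(3) by blast
  then have "app G f x = component \<eta> (Cod A f) (app F f z)"
    using presheaf_homD(4)[OF assms(1,2)] by simp
  then show ?thesis
    using app_simps(3)[OF presheaf_homD(1)[OF assms(1)] assms(2) z(1)] by blast
qed

text \<open>The components of the factor are computed by inverting \<open>\<mu>\<close> on its image; they are natural
  because \<open>\<mu>\<close> is and can be cancelled.\<close>
lemma presheaf_factor:
  assumes \<eta>: "\<eta> \<in> arrow (presheaf_cat A) F H" and \<mu>: "\<mu> \<in> arrow (presheaf_cat A) G H"
    and inj: "inj_on (on_elements \<mu>) (elements A G)"
    and sub: "on_elements \<eta> ` elements A F \<subseteq> on_elements \<mu> ` elements A G"
  obtains \<tau> where "\<tau> \<in> arrow (presheaf_cat A) F G" "\<eta> = \<mu> \<cdot>\<^bsub>presheaf_cat A\<^esub> \<tau>"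
proof -
  note F = presheaf_homD(1)[OF \<eta>] and G = presheaf_homD(1)[OF \<mu>]
  define c where "c X x = inv_into (FObj G X) (component \<mu> X) (component \<eta> X x)" for X x
  have c: "c X x \<in> FObj G X" "component \<mu> X (c X x) = component \<eta> X x"
    if "X \<in> Obj A" "x \<in> FObj F X" for X x
  proof -
    have "component \<eta> X x \<in> component \<mu> X ` FObj G X"
      using sub that unfolding image_on_elements by blast
    then show "c X x \<in> FObj G X" "component \<mu> X (c X x) = component \<eta> X x"
      unfolding c_def by (rule inv_into_into, rule f_inv_into_f)
  qed
  have "c (Cod A f) (app F f x) = app G f (c (Dom A f) x)"
    if f: "f \<in> Arr A" and x: "x \<in> FObj F (Dom A f)" for f x
  proof (rule inj_onD[of "component \<mu> (Cod A f)" "FObj G (Cod A f)"])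
    note objs = A.Dom_Obj[OF f] A.Cod_Obj[OF f]
    show "inj_on (component \<mu> (Cod A f)) (FObj G (Cod A f))"
      using inj objs unfolding inj_on_elements by blast
    show "c (Cod A f) (app F f x) \<in> FObj G (Cod A f)"
      using c(1)[OF objs(2)] app_simps(3)[OF F f x] by blast
    show "app G f (c (Dom A f) x) \<in> FObj G (Cod A f)"
      using app_simps(3)[OF G f] c(1)[OF objs(1) x] by blast
    have "component \<mu> (Cod A f) (app G f (c (Dom A f) x)) = app H f (component \<mu> (Dom A f) (c (Dom A f) x))"
      by (rule presheaf_homD(4)[OF \<mu> f c(1)[OF objs(1) x]])
    also have "\<dots> = component \<eta> (Cod A f) (app F f x)"
      using c(2)[OF objs(1) x] presheaf_homD(4)[OF \<eta> f x] by simp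
    also have "\<dots> = component \<mu> (Cod A f) (c (Cod A f) (app F f x))"
      using c(2)[OF objs(2)] app_simps(3)[OF F f x] by simp
    finally show "component \<mu> (Cod A f) (c (Cod A f) (app F f x))
        = component \<mu> (Cod A f) (app G f (c (Dom A f) x))"
      by simp
  qed
  then obtain \<tau> where \<tau>: "\<tau> \<in> arrow (presheaf_cat A) F G"
      "\<And>X x. \<lbrakk>X \<in> Obj A; x \<in> FObj F X\<rbrakk> \<Longrightarrow> component \<tau> X x = c X x"
    using presheaf_homI[of F G c] F G c(1) by metis
  have "\<eta> = \<mu> \<cdot>\<^bsub>presheaf_cat A\<^esub> \<tau>"
    by (rule presheaf_hom_eqI[OF \<eta> presheaf_Comp(1)[OF \<tau>(1) \<mu>]])
      (simp add: presheaf_Comp(2)[OF \<tau>(1) \<mu>] \<tau>(2) c(2))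
  with \<tau>(1) show thesis
    by (rule that)
qed

text \<open>The kernel pair tests injectivity: its two projections become equal after composition with \<open>\<eta>\<close>.
  It lives in the category only because pairs of elements of \<open>'a\<close> can be coded in \<open>'a\<close>.\<close>
lemma presheaf_kernel_pair:
  fixes \<eta> :: "('o, 'm, 'a) presheaf_hom"
  assumes inf: "infinite (UNIV :: 'a set)" and \<eta>: "\<eta> \<in> arrow (presheaf_cat A) F G"
  obtains K \<pi>\<^sub>1 \<pi>\<^sub>2 where "\<pi>\<^sub>1 \<in> arrow (presheaf_cat A) K F" "\<pi>\<^sub>2 \<in> arrow (presheaf_cat A) K F"
    "\<eta> \<cdot>\<^bsub>presheaf_cat A\<^esub> \<pi>\<^sub>1 = \<eta> \<cdot>\<^bsub>presheaf_cat A\<^esub> \<pi>\<^sub>2"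
    "\<And>X x y. \<lbrakk>X \<in> Obj A; x \<in> FObj F X; y \<in> FObj F X; component \<eta> X x = component \<eta> X y\<rbrakk>
      \<Longrightarrow> \<exists>z \<in> FObj K X. component \<pi>\<^sub>1 X z = x \<and> component \<pi>\<^sub>2 X z = y"
proof -
  obtain J where "bij_betw J ((UNIV :: 'a set) \<times> (UNIV :: 'a set)) (UNIV :: 'a set)"
    using card_of_ordIso[THEN iffD2, OF card_of_Times_same_infinite[OF inf]] by blast
  then have J: "inj J"
    by (simp add: bij_betw_def)
  note F = presheaf_homD(1)[OF \<eta>]
  define Q where "Q X = {(x, y). x \<in> FObj F X \<and> y \<in> FObj F X \<and> component \<eta> X x = component \<eta> X y}" for X
  define \<psi> where "\<psi> f = map_prod (app F f) (app F f)" for f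
  have closed: "\<psi> f q \<in> Q (Cod A f)" if "f \<in> Arr A" "q \<in> Q (Dom A f)" for f q
    using that app_simps(3)[OF F] presheaf_homD(4)[OF \<eta>] by (auto simp: Q_def \<psi>_def)
  obtain K where K: "is_functor A set_cat K" "\<And>X. X \<in> Obj A \<Longrightarrow> FObj K X = J ` Q X"
      "\<And>f q. \<lbrakk>f \<in> Arr A; q \<in> Q (Dom A f)\<rbrakk> \<Longrightarrow> app K f (J q) = J (\<psi> f q)"
    by (rule presheaf_from_action[OF J, of Q \<psi>])
      (use closed app_simps(4,5)[OF F] in \<open>auto simp: Q_def \<psi>_def\<close>)
  have proj: "\<exists>\<pi> \<in> arrow (presheaf_cat A) K F. \<forall>X \<in> Obj A. \<forall>q \<in> Q X. component \<pi> X (J q) = r q"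
    if r: "r = fst \<or> r = snd" for r
  proof -
    let ?c = "\<lambda>X z. r (inv J z)"
    have "?c X z \<in> FObj F X" if "X \<in> Obj A" "z \<in> FObj K X" for X z
      using r that K(2) J by (auto simp: Q_def)
    moreover have "?c (Cod A f) (app K f z) = app F f (?c (Dom A f) z)"
      if f: "f \<in> Arr A" "z \<in> FObj K (Dom A f)" for f z
    proof -
      obtain q where "q \<in> Q (Dom A f)" "z = J q"
        using f K(2)[OF A.Dom_Obj[OF f(1)]] by blast
      then show ?thesis
        using r f(1) K(3) J by (auto simp: \<psi>_def)
    qed
    ultimately obtain \<pi> where "\<pi> \<in> arrow (presheaf_cat A) K F"
        "\<And>X x. \<lbrakk>X \<in> Obj A; x \<in> FObj K X\<rbrakk> \<Longrightarrow> component \<pi> X x = ?c X x"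
      using presheaf_homI[OF K(1) F, of ?c] by blast
    then show ?thesis
      using K(2) J by (intro bexI[of _ \<pi>]) auto
  qed
  obtain \<pi>\<^sub>1 where \<pi>1: "\<pi>\<^sub>1 \<in> arrow (presheaf_cat A) K F"
      "\<And>X q. \<lbrakk>X \<in> Obj A; q \<in> Q X\<rbrakk> \<Longrightarrow> component \<pi>\<^sub>1 X (J q) = fst q"
    using proj[of fst] by blast
  obtain \<pi>\<^sub>2 where \<pi>2: "\<pi>\<^sub>2 \<in> arrow (presheaf_cat A) K F"
      "\<And>X q. \<lbrakk>X \<in> Obj A; q \<in> Q X\<rbrakk> \<Longrightarrow> component \<pi>\<^sub>2 X (J q) = snd q"
    using proj[of snd] by blast
  show thesis
  proof (rule that[OF \<pi>1(1) \<pi>2(1)])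
    show "\<eta> \<cdot>\<^bsub>presheaf_cat A\<^esub> \<pi>\<^sub>1 = \<eta> \<cdot>\<^bsub>presheaf_cat A\<^esub> \<pi>\<^sub>2"
    proof (rule presheaf_hom_eqI[OF presheaf_Comp(1)[OF \<pi>1(1) \<eta>] presheaf_Comp(1)[OF \<pi>2(1) \<eta>]])
      fix X x assume X: "X \<in> Obj A" and x: "x \<in> FObj K X"
      then obtain q where q: "q \<in> Q X" "x = J q"
        using K(2) by blast
      then have "component \<eta> X (component \<pi>\<^sub>1 X x) = component \<eta> X (component \<pi>\<^sub>2 X x)"
        using \<pi>1(2)[OF X q(1)] \<pi>2(2)[OF X q(1)] by (auto simp: Q_def)
      then show "component (\<eta> \<cdot>\<^bsub>presheaf_cat A\<^esub> \<pi>\<^sub>1) X x = component (\<eta> \<cdot>\<^bsub>presheaf_cat A\<^esub> \<pi>\<^sub>2) X x"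
        using presheaf_Comp(2)[OF \<pi>1(1) \<eta> X x] presheaf_Comp(2)[OF \<pi>2(1) \<eta> X x] by simp
    qed
    show "\<exists>z \<in> FObj K X. component \<pi>\<^sub>1 X z = x \<and> component \<pi>\<^sub>2 X z = y"
      if "X \<in> Obj A" "x \<in> FObj F X" "y \<in> FObj F X" "component \<eta> X x = component \<eta> X y" for X x y
    proof -
      have "(x, y) \<in> Q X"
        using that by (simp add: Q_def)
      then show ?thesis
        using \<pi>1(2)[OF that(1)] \<pi>2(2)[OF that(1)] K(2)[OF that(1)] by fastforce
    qed
  qed
qed

lemma presheaf_monic_inj:
  fixes \<eta> :: "('o, 'm, 'a) presheaf_hom"
  assumes inf: "infinite (UNIV :: 'a set)" and \<eta>: "\<eta> \<in> arrow (presheaf_cat A) F G"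
    and mon: "monic (presheaf_cat A) \<eta>"
  shows "inj_on (on_elements \<eta>) (elements A F)"
proof -
  obtain K \<pi>\<^sub>1 \<pi>\<^sub>2 where K: "\<pi>\<^sub>1 \<in> arrow (presheaf_cat A) K F" "\<pi>\<^sub>2 \<in> arrow (presheaf_cat A) K F"
    "\<eta> \<cdot>\<^bsub>presheaf_cat A\<^esub> \<pi>\<^sub>1 = \<eta> \<cdot>\<^bsub>presheaf_cat A\<^esub> \<pi>\<^sub>2"
    "\<And>X x y. \<lbrakk>X \<in> Obj A; x \<in> FObj F X; y \<in> FObj F X; component \<eta> X x = component \<eta> X y\<rbrakk>
      \<Longrightarrow> \<exists>z \<in> FObj K X. component \<pi>\<^sub>1 X z = x \<and> component \<pi>\<^sub>2 X z = y"
    by (rule presheaf_kernel_pair[OF inf \<eta>]) blast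
  have "K \<in> Obj (presheaf_cat A)" "Dom (presheaf_cat A) \<eta> = F"
    using presheaf_homD(1)[OF K(1)] \<eta> by (auto simp: functor_cat_def arrow_def)
  then have eq: "\<pi>\<^sub>1 = \<pi>\<^sub>2"
    using mon K(1-3) unfolding monic_def by blast
  have "x = y"
    if "X \<in> Obj A" "x \<in> FObj F X" "y \<in> FObj F X" "component \<eta> X x = component \<eta> X y" for X x y
    using K(4)[OF that] eq by auto
  then show ?thesis
    unfolding inj_on_elements by (simp add: inj_on_def)
qed

text \<open>The glued object is the pushout of \<open>l\<close> and \<open>k\<close>: at each \<open>X\<close> it is the disjoint sum of \<open>D X\<close> and the
  part of \<open>L X\<close> outside the image of \<open>l\<close>. The map \<open>e X\<close> sends an element of \<open>L X\<close> to its place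
  in this sum. An element outside the image of \<open>l\<close> may be carried into it by an arrow of the index
  category (an edge that is not in \<open>K\<close> may be attached to vertices of \<open>K\<close>), so the action on the second
  summand has to apply \<open>e\<close> again.\<close>
lemma presheaf_glue:
  fixes l :: "('o, 'm, 'a) presheaf_hom"
  assumes inf: "infinite (UNIV :: 'a set)"
    and l: "l \<in> arrow (presheaf_cat A) K L" and k: "k \<in> arrow (presheaf_cat A) K D"
    and m: "m \<in> arrow (presheaf_cat A) L T" and d: "d \<in> arrow (presheaf_cat A) D T"
    and inj: "inj_on (on_elements l) (elements A K)"
    and sq: "m \<cdot>\<^bsub>presheaf_cat A\<^esub> l = d \<cdot>\<^bsub>presheaf_cat A\<^esub> k"
  obtains P p q t where "p \<in> arrow (presheaf_cat A) L P" "q \<in> arrow (presheaf_cat A) D P"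
    "t \<in> arrow (presheaf_cat A) P T"
    "p \<cdot>\<^bsub>presheaf_cat A\<^esub> l = q \<cdot>\<^bsub>presheaf_cat A\<^esub> k"
    "t \<cdot>\<^bsub>presheaf_cat A\<^esub> p = m" "t \<cdot>\<^bsub>presheaf_cat A\<^esub> q = d"
    "inj_on (on_elements q) (elements A D)"
    "on_elements p ` elements A L \<inter> on_elements q ` elements A D
      \<subseteq> on_elements (p \<cdot>\<^bsub>presheaf_cat A\<^esub> l) ` elements A K"
proof -
  note K = presheaf_homD(1)[OF l] and L = presheaf_homD(1)[OF m] and D = presheaf_homD(1)[OF d]
    and T = presheaf_homD(2)[OF d]
  obtain J where "bij_betw J ((UNIV :: 'a set) <+> (UNIV :: 'a set)) (UNIV :: 'a set)"
    using card_of_ordIso[THEN iffD2, OF card_of_Plus_infinite1[OF inf card_of_mono1[OF subset_refl]]]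
    by blast
  then have J: "inj J"
    by (simp add: bij_betw_def)
  have linj: "inj_on (component l X) (FObj K X)" if "X \<in> Obj A" for X
    using inj that unfolding inj_on_elements by blast
  \<comment> \<open>The place in the sum of an element of \<open>L X\<close>, the induced action, and the map induced into \<open>T\<close>.\<close>
  define e where "e X y = (if y \<in> component l X ` FObj K X
    then Inl (component k X (inv_into (FObj K X) (component l X) y)) else Inr y)" for X y
  define Q where "Q X = Inl ` FObj D X \<union> Inr ` (FObj L X - component l X ` FObj K X)" for X
  define \<psi> where "\<psi> f = case_sum (\<lambda>x. Inl (app D f x)) (\<lambda>y. e (Cod A f) (app L f y))" for f
  define \<tau> where "\<tau> X = case_sum (component d X) (component m X)" for X
  have e_l: "e X (component l X z) = Inl (component k X z)" if "X \<in> Obj A" "z \<in> FObj K X" for X z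
    using that linj[OF that(1)] by (simp add: e_def)
  have e_Q: "e X y \<in> Q X" if "X \<in> Obj A" "y \<in> FObj L X" for X y
  proof (cases "y \<in> component l X ` FObj K X")
    case True
    then show ?thesis
      using e_l[OF that(1)] presheaf_homD(3)[OF k that(1)] by (auto simp: Q_def)
  next
    case False
    then show ?thesis
      using that by (simp add: Q_def e_def)
  qed
  have e_nat: "e (Cod A f) (app L f y) = \<psi> f (e (Dom A f) y)"
    if f: "f \<in> Arr A" and y: "y \<in> FObj L (Dom A f)" for f y
  proof (cases "y \<in> component l (Dom A f) ` FObj K (Dom A f)")
    case True
    then obtain z where z: "z \<in> FObj K (Dom A f)" "y = component l (Dom A f) z"
      by blast
    have "e (Cod A f) (app L f y) = e (Cod A f) (component l (Cod A f) (app K f z))"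
      using presheaf_homD(4)[OF l f z(1)] z(2) by simp
    also have "\<dots> = Inl (component k (Cod A f) (app K f z))"
      using e_l[OF A.Cod_Obj[OF f]] app_simps(3)[OF K f z(1)] by simp
    also have "\<dots> = \<psi> f (e (Dom A f) y)"
      using presheaf_homD(4)[OF k f z(1)] e_l[OF A.Dom_Obj[OF f] z(1)] z(2) by (simp add: \<psi>_def)
    finally show ?thesis .
  next
    case False
    then show ?thesis
      by (simp add: e_def[of "Dom A f"] \<psi>_def)
  qed
  have \<psi>_closed: "\<psi> f q \<in> Q (Cod A f)" if f: "f \<in> Arr A" and q: "q \<in> Q (Dom A f)" for f q
  proof -
    from q consider x where "x \<in> FObj D (Dom A f)" "q = Inl x" | y where "y \<in> FObj L (Dom A f)" "q = Inr y"
      unfolding Q_def by blast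
    then show ?thesis
    proof cases
      case 1
      then show ?thesis
        using app_simps(3)[OF D f] by (simp add: Q_def \<psi>_def)
    next
      case 2
      then show ?thesis
        using e_Q[OF A.Cod_Obj[OF f]] app_simps(3)[OF L f] by (simp add: \<psi>_def)
    qed
  qed
  have \<psi>_ident: "\<psi> (Ident A X) q = q" if X: "X \<in> Obj A" and q: "q \<in> Q X" for X q
    using q X app_simps(4)[OF D X] app_simps(4)[OF L X] by (auto simp: Q_def \<psi>_def e_def)
  have \<psi>_comp: "\<psi> (g \<cdot> f) q = \<psi> g (\<psi> f q)"
    if fg: "f \<in> Arr A" "g \<in> Arr A" "Cod A f = Dom A g" and q: "q \<in> Q (Dom A f)" for f g q
  proof -
    from q consider x where "x \<in> FObj D (Dom A f)" "q = Inl x" | y where "y \<in> FObj L (Dom A f)" "q = Inr y"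
      unfolding Q_def by blast
    then show ?thesis
    proof cases
      case 1
      then show ?thesis
        using app_simps(5)[OF D fg] by (simp add: \<psi>_def)
    next
      case 2
      then have "e (Cod A g) (app L g (app L f y)) = \<psi> g (e (Cod A f) (app L f y))"
        using e_nat[OF fg(2)] app_simps(3)[OF L fg(1)] fg(3) by simp
      then show ?thesis
        using app_simps(5)[OF L fg] fg 2 by (simp add: \<psi>_def[of "g \<cdot> f"] \<psi>_def[of f])
    qed
  qed
  obtain P where P: "is_functor A set_cat P" "\<And>X. X \<in> Obj A \<Longrightarrow> FObj P X = J ` Q X"
      "\<And>f q. \<lbrakk>f \<in> Arr A; q \<in> Q (Dom A f)\<rbrakk> \<Longrightarrow> app P f (J q) = J (\<psi> f q)"
    using presheaf_from_action[OF J, of Q \<psi>] \<psi>_closed \<psi>_ident \<psi>_comp by blast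
  have "J (e X y) \<in> FObj P X" if "X \<in> Obj A" "y \<in> FObj L X" for X y
    using e_Q that P(2) by blast
  moreover have "J (e (Cod A f) (app L f y)) = app P f (J (e (Dom A f) y))"
    if "f \<in> Arr A" "y \<in> FObj L (Dom A f)" for f y
    using that e_nat[OF that] P(3)[OF that(1) e_Q[OF A.Dom_Obj[OF that(1)] that(2)]] by simp
  ultimately obtain p where p: "p \<in> arrow (presheaf_cat A) L P"
      "\<And>X y. \<lbrakk>X \<in> Obj A; y \<in> FObj L X\<rbrakk> \<Longrightarrow> component p X y = J (e X y)"
    using presheaf_homI[OF L P(1), of "\<lambda>X y. J (e X y)"] by blast
  have "J (Inl x) \<in> FObj P X" if "X \<in> Obj A" "x \<in> FObj D X" for X x
    using that P(2) by (simp add: Q_def)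
  moreover have "J (Inl (app D f x)) = app P f (J (Inl x))"
    if "f \<in> Arr A" "x \<in> FObj D (Dom A f)" for f x
    using that P(3)[OF that(1), of "Inl x"] by (simp add: Q_def \<psi>_def)
  ultimately obtain q where q: "q \<in> arrow (presheaf_cat A) D P"
      "\<And>X x. \<lbrakk>X \<in> Obj A; x \<in> FObj D X\<rbrakk> \<Longrightarrow> component q X x = J (Inl x)"
    using presheaf_homI[OF D P(1), of "\<lambda>X x. J (Inl x)"] by blast
  have \<tau>_e: "\<tau> X (e X y) = component m X y" if X: "X \<in> Obj A" and y: "y \<in> FObj L X" for X y
  proof (cases "y \<in> component l X ` FObj K X")
    case True
    then obtain z where z: "z \<in> FObj K X" "y = component l X z"
      by blast
    have "component m X (component l X z) = component d X (component k X z)"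
      using presheaf_Comp(2)[OF l m X z(1)] presheaf_Comp(2)[OF k d X z(1)] sq by simp
    then show ?thesis
      using z e_l[OF X z(1)] by (simp add: \<tau>_def)
  next
    case False
    then show ?thesis
      by (simp add: e_def \<tau>_def)
  qed
  have \<tau>: "\<tau> X s \<in> FObj T X" if "X \<in> Obj A" "s \<in> Q X" for X s
    using that presheaf_homD(3)[OF m that(1)] presheaf_homD(3)[OF d that(1)]
    by (auto simp: Q_def \<tau>_def)
  have \<tau>_nat: "\<tau> (Cod A f) (\<psi> f s) = app T f (\<tau> (Dom A f) s)" if f: "f \<in> Arr A" and s: "s \<in> Q (Dom A f)" for f s
  proof -
    from s consider x where "x \<in> FObj D (Dom A f)" "s = Inl x" | y where "y \<in> FObj L (Dom A f)" "s = Inr y"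
      unfolding Q_def by blast
    then show ?thesis
    proof cases
      case 1
      then show ?thesis
        using presheaf_homD(4)[OF d f] by (simp add: \<tau>_def \<psi>_def)
    next
      case 2
      then show ?thesis
        using presheaf_homD(4)[OF m f] \<tau>_e[OF A.Cod_Obj[OF f] app_simps(3)[OF L f]]
        by (simp add: \<tau>_def[of "Dom A f"] \<psi>_def)
    qed
  qed
  have "\<tau> X (inv J z) \<in> FObj T X" if "X \<in> Obj A" "z \<in> FObj P X" for X z
    using that \<tau> P(2) J by auto
  moreover have "\<tau> (Cod A f) (inv J (app P f z)) = app T f (\<tau> (Dom A f) (inv J z))"
    if f: "f \<in> Arr A" "z \<in> FObj P (Dom A f)" for f z
  proof -
    obtain s where "s \<in> Q (Dom A f)" "z = J s"
      using f P(2)[OF A.Dom_Obj[OF f(1)]] by blast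
    then show ?thesis
      using P(3) \<tau>_nat f(1) J by simp
  qed
  ultimately obtain t where t: "t \<in> arrow (presheaf_cat A) P T"
      "\<And>X z. \<lbrakk>X \<in> Obj A; z \<in> FObj P X\<rbrakk> \<Longrightarrow> component t X z = \<tau> X (inv J z)"
    using presheaf_homI[OF P(1) T, of "\<lambda>X z. \<tau> X (inv J z)"] by blast
  have t_J: "component t X (J s) = \<tau> X s" if "X \<in> Obj A" "s \<in> Q X" for X s
    using t(2) P(2) that J by simp
  show thesis
  proof (rule that[OF p(1) q(1) t(1)])
    show "p \<cdot>\<^bsub>presheaf_cat A\<^esub> l = q \<cdot>\<^bsub>presheaf_cat A\<^esub> k"
      by (rule presheaf_hom_eqI[OF presheaf_Comp(1)[OF l p(1)] presheaf_Comp(1)[OF k q(1)]])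
        (simp add: presheaf_Comp(2)[OF l p(1)] presheaf_Comp(2)[OF k q(1)] p(2) q(2) e_l
          presheaf_homD(3)[OF l] presheaf_homD(3)[OF k])
    show "t \<cdot>\<^bsub>presheaf_cat A\<^esub> p = m"
      by (rule presheaf_hom_eqI[OF presheaf_Comp(1)[OF p(1) t(1)] m])
        (simp add: presheaf_Comp(2)[OF p(1) t(1)] p(2) t_J e_Q \<tau>_e)
    show "t \<cdot>\<^bsub>presheaf_cat A\<^esub> q = d"
      by (rule presheaf_hom_eqI[OF presheaf_Comp(1)[OF q(1) t(1)] d])
        (simp add: presheaf_Comp(2)[OF q(1) t(1)] q(2) t_J Q_def \<tau>_def)
    show "inj_on (on_elements q) (elements A D)"
      unfolding inj_on_elements using q(2) injD[OF J] by (fastforce simp: inj_on_def)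
    show "on_elements p ` elements A L \<inter> on_elements q ` elements A D
        \<subseteq> on_elements (p \<cdot>\<^bsub>presheaf_cat A\<^esub> l) ` elements A K"
    proof
      fix v assume "v \<in> on_elements p ` elements A L \<inter> on_elements q ` elements A D"
      then obtain X y x where v: "X \<in> Obj A" "y \<in> FObj L X" "x \<in> FObj D X"
          "v = (X, component p X y)" "component p X y = component q X x"
        unfolding image_on_elements by blast
      then have "e X y = Inl x"
        using p(2) q(2) injD[OF J] by metis
      then obtain z where z: "z \<in> FObj K X" "y = component l X z"
        unfolding e_def by (auto split: if_splits)
      then have "v = (X, component (p \<cdot>\<^bsub>presheaf_cat A\<^esub> l) X z)"
        using v presheaf_Comp(2)[OF l p(1)] by simp
      then show "v \<in> on_elements (p \<cdot>\<^bsub>presheaf_cat A\<^esub> l) ` elements A K"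
        unfolding image_on_elements using v(1) z(1) by blast
    qed
  qed
qed

theorem presheaf_cat_concrete_adhesive:
  assumes inf: "infinite (UNIV :: 'a set)"
  shows "concrete_adhesive (presheaf_cat A :: (('o, 'm, 'a) presheaf, ('o, 'm, 'a) presheaf_hom) cat)
    (elements A) on_elements"
proof -
  let ?C = "presheaf_cat A :: (('o, 'm, 'a) presheaf, ('o, 'm, 'a) presheaf_hom) cat"
  have arr: "f \<in> arrow ?C (Dom ?C f) (Cod ?C f)" if "f \<in> Arr ?C" for f
    using that by (simp add: arrow_def)
  have obj: "F \<in> Obj ?C \<longleftrightarrow> is_functor A set_cat F" for F
    by (simp add: functor_cat_def)
  show ?thesis
  proof
    fix f assume f: "f \<in> Arr ?C"
    show "Dom ?C f \<in> Obj ?C" "Cod ?C f \<in> Obj ?C"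
      using presheaf_homD(1,2)[OF arr[OF f]] by (simp_all add: obj)
    show "on_elements f x \<in> elements A (Cod ?C f)" if "x \<in> elements A (Dom ?C f)" for x
      using that presheaf_homD(3)[OF arr[OF f]] by (auto simp: elements_def on_elements_def)
    fix g assume g: "g \<in> Arr ?C"
    {
      assume fg: "Cod ?C f = Dom ?C g"
      show "g \<cdot>\<^bsub>?C\<^esub> f \<in> arrow ?C (Dom ?C f) (Cod ?C g)"
        using presheaf_Comp(1)[OF arr[OF f] arr[OF g, folded fg]] .
      show "on_elements (g \<cdot>\<^bsub>?C\<^esub> f) x = on_elements g (on_elements f x)"
        if "x \<in> elements A (Dom ?C f)" for x
        using that presheaf_Comp(2)[OF arr[OF f] arr[OF g, folded fg]]
        by (auto simp: elements_def on_elements_def)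
    next
      assume fg: "Dom ?C f = Dom ?C g" "Cod ?C f = Cod ?C g"
        and eq: "\<And>x. x \<in> elements A (Dom ?C f) \<Longrightarrow> on_elements f x = on_elements g x"
      show "f = g"
        using presheaf_hom_eqI[OF arr[OF f] arr[OF g, folded fg]] eq
        by (auto simp: elements_def on_elements_def)
    next
      assume fg: "Cod ?C f = Cod ?C g"
      let ?P = "\<lambda>X. component f X ` FObj (Dom ?C f) X" and ?Q = "\<lambda>X. component g X ` FObj (Dom ?C g) X"
      note g' = arr[OF g, folded fg]
      note sub = presheaf_homD(3)[OF arr[OF f]] presheaf_homD(3)[OF g']
      note closed = presheaf_image_closed[OF arr[OF f]] presheaf_image_closed[OF g']
      obtain S \<iota> where "\<iota> \<in> arrow ?C S (Cod ?C f)" "inj_on (on_elements \<iota>) (elements A S)"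
          "on_elements \<iota> ` elements A S = (SIGMA X : Obj A. ?P X \<inter> ?Q X)"
        by (rule subpresheaf[OF presheaf_homD(2)[OF arr[OF f]], of "\<lambda>X. ?P X \<inter> ?Q X"])
          (use sub closed in blast)+
      then show "\<exists>i \<in> Arr ?C. Cod ?C i = Cod ?C f \<and> inj_on (on_elements i) (elements A (Dom ?C i)) \<and>
          on_elements i ` elements A (Dom ?C i)
            = on_elements f ` elements A (Dom ?C f) \<inter> on_elements g ` elements A (Dom ?C g)"
        by (intro bexI[of _ \<iota>]) (auto simp: arrow_def image_on_elements)
      obtain S \<iota> where "\<iota> \<in> arrow ?C S (Cod ?C f)" "inj_on (on_elements \<iota>) (elements A S)"
          "on_elements \<iota> ` elements A S = (SIGMA X : Obj A. ?P X \<union> ?Q X)"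
        by (rule subpresheaf[OF presheaf_homD(2)[OF arr[OF f]], of "\<lambda>X. ?P X \<union> ?Q X"])
          (use sub closed in blast)+
      then show "\<exists>i \<in> Arr ?C. Cod ?C i = Cod ?C f \<and> inj_on (on_elements i) (elements A (Dom ?C i)) \<and>
          on_elements i ` elements A (Dom ?C i)
            = on_elements f ` elements A (Dom ?C f) \<union> on_elements g ` elements A (Dom ?C g)"
        by (intro bexI[of _ \<iota>]) (auto simp: arrow_def image_on_elements)
      assume "inj_on (on_elements g) (elements A (Dom ?C g))"
        "on_elements f ` elements A (Dom ?C f) \<subseteq> on_elements g ` elements A (Dom ?C g)"
      then show "\<exists>t \<in> arrow ?C (Dom ?C f) (Dom ?C g). f = g \<cdot>\<^bsub>?C\<^esub> t"
        using presheaf_factor[OF arr[OF f] g'] by blast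
    }
  next
    fix F assume "F \<in> Obj ?C"
    then show "Ident ?C F \<in> arrow ?C F F"
        "\<And>x. x \<in> elements A F \<Longrightarrow> on_elements (Ident ?C F) x = x"
      using presheaf_Ident[of F] by (auto simp: obj elements_def on_elements_def)
  next
    fix f assume "monic ?C f"
    then show "inj_on (on_elements f) (elements A (Dom ?C f))"
      using presheaf_monic_inj[OF inf arr] by (simp add: monic_def)
  next
    fix l k m d
    assume types: "{l, k, m, d} \<subseteq> Arr ?C" "Dom ?C l = Dom ?C k" "Dom ?C m = Cod ?C l"
        "Dom ?C d = Cod ?C k" "Cod ?C m = Cod ?C d" "m \<cdot>\<^bsub>?C\<^esub> l = d \<cdot>\<^bsub>?C\<^esub> k"
        "inj_on (on_elements l) (elements A (Dom ?C l))"
    then have "l \<in> arrow ?C (Dom ?C l) (Cod ?C l)" "k \<in> arrow ?C (Dom ?C l) (Cod ?C k)"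
        "m \<in> arrow ?C (Cod ?C l) (Cod ?C m)" "d \<in> arrow ?C (Cod ?C k) (Cod ?C m)"
      by (auto simp: arrow_def)
    from presheaf_glue[OF inf this types(7,6)]
    obtain P p q t where pq: "p \<in> arrow ?C (Cod ?C l) P" "q \<in> arrow ?C (Cod ?C k) P"
        "t \<in> arrow ?C P (Cod ?C m)" "p \<cdot>\<^bsub>?C\<^esub> l = q \<cdot>\<^bsub>?C\<^esub> k" "t \<cdot>\<^bsub>?C\<^esub> p = m" "t \<cdot>\<^bsub>?C\<^esub> q = d"
        "inj_on (on_elements q) (elements A (Cod ?C k))"
        "on_elements p ` elements A (Cod ?C l) \<inter> on_elements q ` elements A (Cod ?C k)
          \<subseteq> on_elements (p \<cdot>\<^bsub>?C\<^esub> l) ` elements A (Dom ?C l)"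
      by metis
    moreover have "p \<cdot>\<^bsub>?C\<^esub> l \<in> arrow ?C (Dom ?C l) P"
      using presheaf_Comp(1)[of l "Dom ?C l" "Cod ?C l" p P] pq(1) arr[of l] types(1) by simp
    ultimately show "\<exists>P p q t. p \<in> arrow ?C (Cod ?C l) P \<and> q \<in> arrow ?C (Cod ?C k) P \<and>
        t \<in> arrow ?C P (Cod ?C m) \<and> p \<cdot>\<^bsub>?C\<^esub> l = q \<cdot>\<^bsub>?C\<^esub> k \<and> t \<cdot>\<^bsub>?C\<^esub> p = m \<and> t \<cdot>\<^bsub>?C\<^esub> q = d \<and>
        inj_on (on_elements q) (elements A (Dom ?C q)) \<and>
        on_elements p ` elements A (Dom ?C p) \<inter> on_elements q ` elements A (Dom ?C q)
          \<subseteq> on_elements (p \<cdot>\<^bsub>?C\<^esub> l) ` elements A (Dom ?C (p \<cdot>\<^bsub>?C\<^esub> l))"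
      by (intro exI[of _ P] exI[of _ p] exI[of _ q] exI[of _ t]) (auto simp: arrow_def)
  qed
qed

end


section \<open>Slices\<close>

context concrete_adhesive
begin

text \<open>An arrow of a slice is determined by its middle component and its target, as its source is their
  composite. Writing the source in this way keeps the equation between them out of later
  arguments.\<close>
lemma slice_Arr_iff:
  "t \<in> Arr (slice_cat C S) \<longleftrightarrow>
     (\<exists>f q. t = (q \<cdot> f, f, q) \<and> q \<in> Arr C \<and> Cod C q = S \<and> f \<in> Arr C \<and> Cod C f = Dom C q)"
  by (auto simp: slice_cat_def arrow_def)

lemma slice_simps [simp]:
  "Dom (slice_cat C S) (p, f, q) = p" "Cod (slice_cat C S) (p, f, q) = q"
  "Ident (slice_cat C S) p = (p, Ident C (Dom C p), p)"
  "(q', g, r) \<cdot>\<^bsub>slice_cat C S\<^esub> (p, f, q) = (p, g \<cdot> f, r)"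
  "p \<in> Obj (slice_cat C S) \<longleftrightarrow> p \<in> Arr C \<and> Cod C p = S"
  by (auto simp: slice_cat_def)

lemma slice_arrow_iff:
  "t \<in> arrow (slice_cat C S) p q \<longleftrightarrow>
     (\<exists>f. t = (p, f, q) \<and> p = q \<cdot> f \<and> q \<in> Arr C \<and> Cod C q = S \<and> f \<in> Arr C \<and> Cod C f = Dom C q)"
  by (auto simp: arrow_def slice_Arr_iff)

text \<open>A monomorphism of the slice is monic in the base: two arrows that \<open>f\<close> makes equal have the same
  composite with \<open>q f\<close>, so they are parallel arrows over \<open>S\<close>.\<close>
lemma slice_monic_imp_inj:
  assumes mon: "monic (slice_cat C S) (q \<cdot> f, f, q)"
    and q: "q \<in> Arr C" "Cod C q = S" and f: "f \<in> Arr C" "Cod C f = Dom C q"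
  shows "inj_on (act f) (el (Dom C f))"
proof -
  have "monic C f"
    unfolding monic_def
  proof (intro conjI ballI impI f)
    fix X g h
    assume X: "X \<in> Obj C" "g \<in> arrow C X (Dom C f)" "h \<in> arrow C X (Dom C f)" and eq: "f \<cdot> g = f \<cdot> h"
    then have gh: "g \<in> Arr C" "Dom C g = X" "Cod C g = Dom C f" "h \<in> Arr C" "Dom C h = X" "Cod C h = Dom C f"
      by (auto simp: arrow_def)
    have eq': "q \<cdot> f \<cdot> h = q \<cdot> f \<cdot> g"
      using assoc[of h f q] assoc[of g f q] f q gh eq by simp
    have "(q \<cdot> f \<cdot> g, g, q \<cdot> f) = (q \<cdot> f \<cdot> g, h, q \<cdot> f)"
    proof (rule mon[unfolded monic_def, THEN conjunct2, rule_format])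
      show "q \<cdot> f \<cdot> g \<in> Obj (slice_cat C S)"
        using f q gh by simp
    qed (use f q gh eq eq' in \<open>auto simp: slice_arrow_iff\<close>)
    then show "g = h"
      by simp
  qed
  then show ?thesis
    by (rule monic_imp_inj)
qed

text \<open>The elements of an object \<open>p\<close> over \<open>S\<close> are those of its domain. All constructions are made in the
  base category; an object that comes with an arrow into the domain of an object over \<open>S\<close> is itself
  over \<open>S\<close>, by composition.\<close>
theorem slice_concrete_adhesive:
  "concrete_adhesive (slice_cat C S) (\<lambda>p. el (Dom C p)) (\<lambda>t. act (fst (snd t)))"
proof -
  let ?D = "slice_cat C S"
  show ?thesis
  proof
    fix p assume p: "p \<in> Obj ?D"
    then show "Ident ?D p \<in> arrow ?D p p"
      using Dom_Obj[of p] by (auto simp: slice_arrow_iff)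
    show "act (fst (snd (Ident ?D p))) x = x" if "x \<in> el (Dom C p)" for x
      using p that Dom_Obj[of p] by (simp add: act_Ident)
  next
    fix t assume "t \<in> Arr ?D"
    then obtain f q where t: "t = (q \<cdot> f, f, q)" and f: "q \<in> Arr C" "Cod C q = S" "f \<in> Arr C"
        "Cod C f = Dom C q"
      unfolding slice_Arr_iff by blast
    show "Dom ?D t \<in> Obj ?D" "Cod ?D t \<in> Obj ?D"
      using f t by auto
    show "act (fst (snd t)) x \<in> el (Dom C (Cod ?D t))" if "x \<in> el (Dom C (Dom ?D t))" for x
      using that f t act_in_el[of f "Dom C q" x] by simp
    fix t' assume "t' \<in> Arr ?D"
    then obtain f' q' where t': "t' = (q' \<cdot> f', f', q')" and f': "q' \<in> Arr C" "Cod C q' = S"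
        "f' \<in> Arr C" "Cod C f' = Dom C q'"
      unfolding slice_Arr_iff by blast
    {
      assume comp: "Cod ?D t = Dom ?D t'"
      then show "t' \<cdot>\<^bsub>?D\<^esub> t \<in> arrow ?D (Dom ?D t) (Cod ?D t')"
        using f f' t t' by (auto simp: slice_arrow_iff assoc)
      show "act (fst (snd (t' \<cdot>\<^bsub>?D\<^esub> t))) x = act (fst (snd t')) (act (fst (snd t)) x)"
        if "x \<in> el (Dom C (Dom ?D t))" for x
        using that comp f f' t t' by (simp add: act_Comp)
    next
      assume eq: "Dom ?D t = Dom ?D t'" "Cod ?D t = Cod ?D t'"
        "\<And>x. x \<in> el (Dom C (Dom ?D t)) \<Longrightarrow> act (fst (snd t)) x = act (fst (snd t')) x"
      have "Dom C f = Dom C f'"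
        using arg_cong[OF eq(1), of "Dom C"] f f' t t' by simp
      then show "t = t'"
        using eq f f' t t' faithful[of f f'] by simp
    next
      assume cod: "Cod ?D t = Cod ?D t'"
      obtain i where i: "i \<in> Arr C" "Cod C i = Cod C f" "inj_on (act i) (el (Dom C i))"
          "im i = im f \<inter> im f'"
        using Int_image[of f f'] f f' cod t t' by auto
      then show "\<exists>i \<in> Arr ?D. Cod ?D i = Cod ?D t \<and>
          inj_on (act (fst (snd i))) (el (Dom C (Dom ?D i))) \<and>
          act (fst (snd i)) ` el (Dom C (Dom ?D i)) =
            act (fst (snd t)) ` el (Dom C (Dom ?D t)) \<inter> act (fst (snd t')) ` el (Dom C (Dom ?D t'))"
        using f f' t t' by (intro bexI[of _ "(q \<cdot> i, i, q)"]) (auto simp: slice_Arr_iff im_def)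
      obtain i where i: "i \<in> Arr C" "Cod C i = Cod C f" "inj_on (act i) (el (Dom C i))"
          "im i = im f \<union> im f'"
        using Un_image[of f f'] f f' cod t t' by auto
      then show "\<exists>i \<in> Arr ?D. Cod ?D i = Cod ?D t \<and>
          inj_on (act (fst (snd i))) (el (Dom C (Dom ?D i))) \<and>
          act (fst (snd i)) ` el (Dom C (Dom ?D i)) =
            act (fst (snd t)) ` el (Dom C (Dom ?D t)) \<union> act (fst (snd t')) ` el (Dom C (Dom ?D t'))"
        using f f' t t' by (intro bexI[of _ "(q \<cdot> i, i, q)"]) (auto simp: slice_Arr_iff im_def)
      assume inj: "inj_on (act (fst (snd t'))) (el (Dom C (Dom ?D t')))"
        and sub: "act (fst (snd t)) ` el (Dom C (Dom ?D t))
          \<subseteq> act (fst (snd t')) ` el (Dom C (Dom ?D t'))"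
      then have "\<exists>s \<in> arrow C (Dom C f) (Dom C f'). f = f' \<cdot> s"
        using f f' t t' cod by (intro factor) (simp_all add: im_def)
      then obtain s where s: "s \<in> Arr C" "Dom C s = Dom C f" "Cod C s = Dom C f'" "f' \<cdot> s = f"
        unfolding arrow_def by blast
      have "q' \<cdot> f' \<cdot> s = q \<cdot> f"
        using s f f' cod t t' assoc[of s f' q'] by simp
      then show "\<exists>s \<in> arrow ?D (Dom ?D t) (Dom ?D t'). t = t' \<cdot>\<^bsub>?D\<^esub> s"
        using f f' t t' cod s by (intro bexI[of _ "(q \<cdot> f, s, q' \<cdot> f')"]) (auto simp: slice_arrow_iff)
    }
  next
    fix t assume t: "monic ?D t"
    then obtain f q where f: "t = (q \<cdot> f, f, q)" "q \<in> Arr C" "Cod C q = S" "f \<in> Arr C"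
        "Cod C f = Dom C q"
      unfolding monic_def slice_Arr_iff by blast
    then show "inj_on (act (fst (snd t))) (el (Dom C (Dom ?D t)))"
      using slice_monic_imp_inj[of S q f] t by simp
  next
    fix tl tk tm td
    assume arr: "{tl, tk, tm, td} \<subseteq> Arr ?D"
      and types: "Dom ?D tl = Dom ?D tk" "Dom ?D tm = Cod ?D tl" "Dom ?D td = Cod ?D tk"
        "Cod ?D tm = Cod ?D td"
      and sq: "tm \<cdot>\<^bsub>?D\<^esub> tl = td \<cdot>\<^bsub>?D\<^esub> tk"
      and inj: "inj_on (act (fst (snd tl))) (el (Dom C (Dom ?D tl)))"
    obtain l b where l: "tl = (b \<cdot> l, l, b)" "b \<in> Arr C" "Cod C b = S" "l \<in> Arr C" "Cod C l = Dom C b"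
      using arr by (auto simp: slice_Arr_iff)
    obtain k c where k: "tk = (c \<cdot> k, k, c)" "c \<in> Arr C" "Cod C c = S" "k \<in> Arr C" "Cod C k = Dom C c"
      using arr by (auto simp: slice_Arr_iff)
    obtain m e where m: "tm = (e \<cdot> m, m, e)" "e \<in> Arr C" "Cod C e = S" "m \<in> Arr C" "Cod C m = Dom C e"
      using arr by (auto simp: slice_Arr_iff)
    obtain d e' where d: "td = (e' \<cdot> d, d, e')" "d \<in> Arr C" "Cod C d = Dom C e'"
      using arr by (auto simp: slice_Arr_iff)
    have em: "e \<cdot> m = b" and ed: "e' = e" "e \<cdot> d = c" and bl: "b \<cdot> l = c \<cdot> k"
      using types l k m d by auto
    then have dom: "Dom C m = Cod C l" "Dom C d = Cod C k" "Dom C l = Dom C k" "Cod C m = Cod C d"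
      using l k m d Comp_simps(2)[of m e] Comp_simps(2)[of d e]
        Comp_simps(2)[of l b] Comp_simps(2)[of k c] by auto
    have sq': "m \<cdot> l = d \<cdot> k"
      using sq l k m d by simp
    obtain P p q t where pq: "p \<in> arrow C (Cod C l) P" "q \<in> arrow C (Cod C k) P"
        "t \<in> arrow C P (Cod C m)" "p \<cdot> l = q \<cdot> k" "t \<cdot> p = m" "t \<cdot> q = d"
        "inj_on (act q) (el (Dom C q))" "im p \<inter> im q \<subseteq> im (p \<cdot> l)"
    proof -
      have "inj_on (act l) (el (Dom C l))" "{l, k, m, d} \<subseteq> Arr C"
        using inj l k m d by simp_all
      then show thesis
        using glue[of l k m d] dom sq' that by blast
    qed
    then have arrs: "p \<in> Arr C" "Dom C p = Dom C b" "Cod C p = P" "q \<in> Arr C" "Dom C q = Dom C c"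
        "Cod C q = P" "t \<in> Arr C" "Dom C t = P" "Cod C t = Dom C e"
      using l k m d by (auto simp: arrow_def)
    have over: "e \<cdot> t \<cdot> p = b" "e \<cdot> t \<cdot> q = c"
      using assoc[of p t e] assoc[of q t e] arrs pq(5,6) m(2) em ed by simp_all
    let ?P = "e \<cdot> t"
    show "\<exists>P p q t. p \<in> arrow ?D (Cod ?D tl) P \<and> q \<in> arrow ?D (Cod ?D tk) P \<and> t \<in> arrow ?D P (Cod ?D tm) \<and>
        p \<cdot>\<^bsub>?D\<^esub> tl = q \<cdot>\<^bsub>?D\<^esub> tk \<and> t \<cdot>\<^bsub>?D\<^esub> p = tm \<and> t \<cdot>\<^bsub>?D\<^esub> q = td \<and>
        inj_on (act (fst (snd q))) (el (Dom C (Dom ?D q))) \<and>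
        act (fst (snd p)) ` el (Dom C (Dom ?D p)) \<inter> act (fst (snd q)) ` el (Dom C (Dom ?D q))
          \<subseteq> act (fst (snd (p \<cdot>\<^bsub>?D\<^esub> tl))) ` el (Dom C (Dom ?D (p \<cdot>\<^bsub>?D\<^esub> tl)))"
    proof (rule exI[of _ ?P], rule exI[of _ "(b, p, ?P)"], rule exI[of _ "(c, q, ?P)"],
        rule exI[of _ "(?P, t, e)"], intro conjI)
      show "act (fst (snd (b, p, ?P))) ` el (Dom C (Dom ?D (b, p, ?P))) \<inter>
          act (fst (snd (c, q, ?P))) ` el (Dom C (Dom ?D (c, q, ?P)))
          \<subseteq> act (fst (snd ((b, p, ?P) \<cdot>\<^bsub>?D\<^esub> tl))) ` el (Dom C (Dom ?D ((b, p, ?P) \<cdot>\<^bsub>?D\<^esub> tl)))"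
        using pq(8) arrs l Comp_simps(2)[of l p] by (simp add: im_def)
    qed (use l k m d arrs pq(4-7) over em ed bl in \<open>simp_all add: slice_arrow_iff\<close>)
  qed
qed

end


section \<open>Typed hypergraphs\<close>

lemma is_path_append:
  "is_path W Q s t x (es @ es') z \<longleftrightarrow> (\<exists>y. is_path W Q s t x es y \<and> is_path W Q s t y es' z)"
proof (induction es arbitrary: x)
  case Nil
  show ?case
    by (cases es') auto
qed auto

lemma free_cat_precategory:
  assumes "\<And>e. e \<in> Q \<Longrightarrow> s e \<in> W"
  shows "precategory (free_cat W Q s t)"
proof -
  have ends: "x \<in> W \<and> y \<in> W" if "is_path W Q s t x es y" for x es y
    using that by (induction es arbitrary: x) auto
  show ?thesis
    by standard (use ends in \<open>auto simp: free_cat_def arrow_def is_path_append\<close>)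
qed

theorem typed_hgraph_concrete_adhesive:
  fixes \<Sigma> :: "'a hgraph"
  assumes "infinite (UNIV :: 'a set)"
  shows "concrete_adhesive (typed_hgraph_cat \<Sigma>)
    (\<lambda>p. elements H_cat (Dom hgraph_cat p)) (\<lambda>t. on_elements (fst (snd t)))"
proof -
  have "precategory H_cat"
    unfolding H_cat_def by (rule free_cat_precategory) simp
  then have "concrete_adhesive (hgraph_cat :: ('a hgraph, 'a hgraph_hom) cat) (elements H_cat) on_elements"
    unfolding hgraph_cat_def using assms by (rule presheaf_cat_concrete_adhesive)
  then show ?thesis
    unfolding typed_hgraph_cat_def by (rule concrete_adhesive.slice_concrete_adhesive)
qed

theorem theorem6p2:
  fixes \<Sigma> :: "'a hgraph"
    and C :: "('a typed_hgraph, 'a typed_hgraph_hom) cat"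
    and G\<^sub>0 G\<^sub>n :: "'a typed_hgraph"
    and \<pi> :: "'a typed_hgraph_hom derivation list"
    and u v :: "'a typed_hgraph_hom"
  assumes "infinite (UNIV :: 'a set)"
    and "\<Sigma> \<in> Obj hgraph_cat"
    and "C = typed_hgraph_cat \<Sigma>"
    and "derivation_path C G\<^sub>0 \<pi> G\<^sub>n"
    and "(u, v) \<in> reps (trk_path C G\<^sub>0 \<pi>)"
    and "monic C u" and "monic C v"
  shows "(\<forall>A \<in> carrier (Sub C G\<^sub>0).
            transports_intact C \<pi> A \<longleftrightarrow> A \<sqsubseteq>\<^bsub>Sub C G\<^sub>0\<^esub> sub_class C u) \<and>
         greatest (Sub C G\<^sub>0) (sub_class C u)
           {A \<in> carrier (Sub C G\<^sub>0). transports_intact C \<pi> A}"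
proof -
  interpret concrete_adhesive C "\<lambda>p. elements H_cat (Dom hgraph_cat p)" "\<lambda>t. on_elements (fst (snd t))"
    "\<lambda>f. on_elements (fst (snd f)) ` elements H_cat (Dom hgraph_cat (Dom C f))"
    unfolding assms(3) by (rule typed_hgraph_concrete_adhesive[OF assms(1)])
  show ?thesis
    using transports_intact_iff[OF assms(4,5)] greatest_transport_domain[OF assms(4,5)] by blast
qed

end
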